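(* Let $\mathcal{T}$ be a countable directed poset, $X:\mathcal{T}\to\mathbf{Set}_*$ a diagram of pointed sets satisfying the Mittag-Leffler condition, and $A$ an abelian group. Then the cokernel $H(X,A)$ of the natural map $\rho:(\lim_\mathcal{T}X)\wedge A\to\lim_\mathcal{T}(X\wedge A)$ is algebraically compact.
   Context: A directed poset is regarded as a category with a single morphism $t\to s$ whenever $t\ge s$. For a pointed set $Y$, $Y\wedge A:=\bigoplus_{Y\setminus\{*\}}A$ (finitely supported pointed maps $Y\to A$), functorial via $f_*(sv)=f(s)v$, where $sv$ is the element with value $v$ at $s$ ($*v=0$); $\rho(xv)(t)=x(t)v$, and $H(X,A):=\lim_\mathcal{T}(X\wedge A)/\mathrm{Im}\,\rho$. $X$ satisfies the Mittag-Leffler condition if for every $t$ there is $s\ge t$ with $\mathrm{Im}(X(s)\to X(t))=\mathrm{Im}(X(r)\to X(t))$ for all $r\ge s$. An abelian group is algebraically compact if it is a direct summand of every abelian group containing it as a pure subgroup (equivalently, it is cotorsion and has Ulm length at most $1$). *)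

theory Defs
  imports "HOL-Algebra.Algebra" "HOL-Library.Countable_Set"
begin

definition smash :: "'x set \<Rightarrow> 'x \<Rightarrow> ('x \<Rightarrow> 'a::ab_group_add) set" where
  "smash Y b = {g. (\<forall>y. (y \<notin> Y \<or> y = b) \<longrightarrow> g y = 0) \<and> finite {y. g y \<noteq> 0}}"

text \<open>Functoriality f_* of Y \<and> A in a pointed map f (target base point b'):
  f_*(s v) = f(s) v, with (base) v = 0, extended additively.\<close>
definition push :: "('x \<Rightarrow> 'y) \<Rightarrow> 'y \<Rightarrow> ('x \<Rightarrow> 'a::ab_group_add) \<Rightarrow> ('y \<Rightarrow> 'a)" where
  "push f b' g = (\<lambda>y. if y = b' then 0 else (\<Sum>x\<in>{x. g x \<noteq> 0 \<and> f x = y}. g x))"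

text \<open>A diagram X : T \<rightarrow> Set_* over a poset (morphism t \<rightarrow> s iff t \<ge> s):
  carriers X t, base points b t, transition maps f t s : X t \<rightarrow> X s for s \<le> t.\<close>
definition pointed_diagram :: "('t::order \<Rightarrow> 'x set) \<Rightarrow> ('t \<Rightarrow> 'x) \<Rightarrow> ('t \<Rightarrow> 't \<Rightarrow> 'x \<Rightarrow> 'x) \<Rightarrow> bool" where
  "pointed_diagram P b f \<longleftrightarrow>
     (\<forall>t. b t \<in> P t) \<and>
     (\<forall>t s. s \<le> t \<longrightarrow> f t s ` P t \<subseteq> P s \<and> f t s (b t) = b s) \<and>
     (\<forall>t. \<forall>x\<in>P t. f t t x = x) \<and>
     (\<forall>t s r. r \<le> s \<and> s \<le> t \<longrightarrow> (\<forall>x\<in>P t. f s r (f t s x) = f t r x))"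

definition directed_poset :: "'t::order itself \<Rightarrow> bool" where
  "directed_poset _ \<longleftrightarrow> (\<forall>s t::'t. \<exists>r. s \<le> r \<and> t \<le> r)"

definition mittag_leffler :: "('t::order \<Rightarrow> 'x set) \<Rightarrow> ('t \<Rightarrow> 't \<Rightarrow> 'x \<Rightarrow> 'x) \<Rightarrow> bool" where
  "mittag_leffler P f \<longleftrightarrow>
     (\<forall>t. \<exists>s\<ge>t. \<forall>r\<ge>s. f s t ` P s = f r t ` P r)"

definition lim_pset :: "('t::order \<Rightarrow> 'x set) \<Rightarrow> ('t \<Rightarrow> 't \<Rightarrow> 'x \<Rightarrow> 'x) \<Rightarrow> ('t \<Rightarrow> 'x) set" where
  "lim_pset P f = {x. (\<forall>t. x t \<in> P t) \<and> (\<forall>t s. s \<le> t \<longrightarrow> f t s (x t) = x s)}"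

definition lim_smash :: "('t::order \<Rightarrow> 'x set) \<Rightarrow> ('t \<Rightarrow> 'x) \<Rightarrow> ('t \<Rightarrow> 't \<Rightarrow> 'x \<Rightarrow> 'x)
     \<Rightarrow> ('t \<Rightarrow> 'x \<Rightarrow> 'a::ab_group_add) set" where
  "lim_smash P b f = {G. (\<forall>t. G t \<in> smash (P t) (b t)) \<and>
                         (\<forall>t s. s \<le> t \<longrightarrow> push (f t s) (b s) (G t) = G s)}"

definition lim_smash_group :: "('t::order \<Rightarrow> 'x set) \<Rightarrow> ('t \<Rightarrow> 'x) \<Rightarrow> ('t \<Rightarrow> 't \<Rightarrow> 'x \<Rightarrow> 'x)
     \<Rightarrow> ('t \<Rightarrow> 'x \<Rightarrow> 'a::ab_group_add) monoid" where
  "lim_smash_group P b f = \<lparr>carrier = lim_smash P b f, monoid.mult = (\<lambda>G G' t y. G t y + G' t y), monoid.one = (\<lambda>t y. 0)\<rparr>"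

text \<open>rho : (lim X) \<and> A \<rightarrow> lim (X \<and> A), rho(x v)(t) = x(t) v, i.e. push-forward
  along the evaluation maps lim X \<rightarrow> P t.\<close>
definition rho :: "('t \<Rightarrow> 'x) \<Rightarrow> (('t \<Rightarrow> 'x) \<Rightarrow> 'a::ab_group_add) \<Rightarrow> ('t \<Rightarrow> 'x \<Rightarrow> 'a)" where
  "rho b g = (\<lambda>t. push (\<lambda>x. x t) (b t) g)"

definition rho_image :: "('t::order \<Rightarrow> 'x set) \<Rightarrow> ('t \<Rightarrow> 'x) \<Rightarrow> ('t \<Rightarrow> 't \<Rightarrow> 'x \<Rightarrow> 'x)
     \<Rightarrow> ('t \<Rightarrow> 'x \<Rightarrow> 'a::ab_group_add) set" where
  "rho_image P b f = rho b ` smash (lim_pset P f) b"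

definition H_group :: "('t::order \<Rightarrow> 'x set) \<Rightarrow> ('t \<Rightarrow> 'x) \<Rightarrow> ('t \<Rightarrow> 't \<Rightarrow> 'x \<Rightarrow> 'x)
     \<Rightarrow> 'a::ab_group_add itself \<Rightarrow> ('t \<Rightarrow> 'x \<Rightarrow> 'a) set monoid" where
  "H_group P b f _ = lim_smash_group P b f Mod rho_image P b f"

definition pure_subgroup :: "'b set \<Rightarrow> ('b, 'm) monoid_scheme \<Rightarrow> bool" where
  "pure_subgroup S B \<longleftrightarrow> subgroup S B \<and>
     (\<forall>n::nat. n > 0 \<longrightarrow> (\<forall>s\<in>S. (\<exists>y\<in>carrier B. y [^]\<^bsub>B\<^esub> n = s) \<longrightarrow>
                                    (\<exists>y\<in>S. y [^]\<^bsub>B\<^esub> n = s)))"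

text \<open>Algebraic compactness, tested against all abelian groups B whose elements
  live in the type 'b: whenever H embeds into B as a pure subgroup, its image
  is a direct summand. (The theorem is stated for an arbitrary type 'b.)\<close>
definition alg_compact :: "('c, 'm) monoid_scheme \<Rightarrow> 'b itself \<Rightarrow> bool" where
  "alg_compact H _ \<longleftrightarrow> comm_group H \<and>
     (\<forall>(B::'b monoid) h. comm_group B \<and> h \<in> hom H B \<and> inj_on h (carrier H) \<and>
        pure_subgroup (h ` carrier H) B \<longrightarrow>
        (\<exists>C. subgroup C B \<and> h ` carrier H \<inter> C = {\<one>\<^bsub>B\<^esub>} \<and>
             (h ` carrier H) <#>\<^bsub>B\<^esub> C = carrier B))"

end

theory Submission
  imports Defs "HOL-Library.Function_Algebras"
begin

text \<open>Write \<open>L\<close> for the limit of the \<open>X \<and> A\<close>, \<open>N\<close> for the image of \<open>\<rho>\<close> and \<open>H = L / N\<close>. Two facts about the pair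
  \<open>(L, N)\<close> matter. First, every finite subset of \<open>N\<close> is fixed by some homomorphism \<open>L \<rightarrow> N\<close>. Second,
  there is an additive map \<open>\<Lambda> : L\<^sup>\<nat> \<rightarrow> H\<close> sending a sequence that is eventually equal to \<open>a\<close> to the class
  of \<open>a\<close>: along a cofinal sequence of indices, the Mittag-Leffler condition allows one to truncate
  elements of \<open>L\<close> to elements of \<open>N\<close>, and \<open>\<Lambda>\<close> adds up the successive differences of truncations.

  Let \<open>H\<close> be pure in \<open>B\<close>. By Zorn's lemma it is enough to extend a homomorphism \<open>r : M \<rightarrow> H\<close> from a pure
  subgroup \<open>M \<subseteq> B\<close> to a larger pure subgroup \<open>M + D\<close> with \<open>D\<close> countable. Over finitely many elements of
  \<open>D\<close> an extension exists since \<open>M\<close> is pure. Lifting the values of these finite extensions to \<open>L\<close>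
  gives maps that are additive up to errors in \<open>N\<close>; the first fact allows one to choose the lifts so that
  each error stays constant from some stage on, and then \<open>\<Lambda>\<close> turns the sequence of lifts into an
  honest homomorphism on \<open>D\<close>.\<close>

subsection \<open>Pure subgroups\<close>

text \<open>Two factorizations of one element differ by some \<open>p\<close> in the intersection of
  \<open>M\<close> and \<open>D\<close>; since \<open>r\<close> and \<open>x\<close> agree at
  \<open>p\<close>, the product of their values does not depend on the factorization.\<close>

lemma (in comm_group) hom_glue:
  assumes M: "subgroup M G" and D: "subgroup D G" and H: "comm_group H"
    and r: "r \<in> hom (G\<lparr>carrier := M\<rparr>) H" and x: "x \<in> hom (G\<lparr>carrier := D\<rparr>) H"
    and agree: "\<And>z. z \<in> M \<Longrightarrow> z \<in> D \<Longrightarrow> r z = x z"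
  obtains g where "g \<in> hom (G\<lparr>carrier := M <#> D\<rparr>) H"
    and "\<And>m d. m \<in> M \<Longrightarrow> d \<in> D \<Longrightarrow> g (m \<otimes> d) = r m \<otimes>\<^bsub>H\<^esub> x d"
proof -
  interpret H: comm_group H by (rule H)
  interpret M: subgroup M G by (rule M)
  interpret D: subgroup D G by (rule D)
  have r_closed: "r m \<in> carrier H" if "m \<in> M" for m using r that by (auto simp: hom_def)
  have x_closed: "x d \<in> carrier H" if "d \<in> D" for d using x that by (auto simp: hom_def)
  have r_mult: "r (m \<otimes> m') = r m \<otimes>\<^bsub>H\<^esub> r m'" if "m \<in> M" "m' \<in> M" for m m'
    using r that by (auto simp: hom_def)
  have x_mult: "x (d \<otimes> d') = x d \<otimes>\<^bsub>H\<^esub> x d'" if "d \<in> D" "d' \<in> D" for d d'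
    using x that by (auto simp: hom_def)
  have well_defined: "r m \<otimes>\<^bsub>H\<^esub> x d = r m' \<otimes>\<^bsub>H\<^esub> x d'"
    if md: "m \<in> M" "d \<in> D" "m' \<in> M" "d' \<in> D" and eq: "m \<otimes> d = m' \<otimes> d'" for m d m' d'
  proof -
    define p where "p = inv m' \<otimes> m"
    have carr: "m \<in> carrier G" "m' \<in> carrier G" "d \<in> carrier G" "d' \<in> carrier G"
      using md by auto
    have p_M: "p \<in> M" using md by (simp add: p_def)
    have m: "m = m' \<otimes> p" using carr by (simp add: p_def m_assoc[symmetric])
    have "m' \<otimes> (p \<otimes> d) = m' \<otimes> d'" using eq carr p_M by (simp add: m m_assoc)
    then have d': "d' = p \<otimes> d" using carr p_M by simp
    have "p = d' \<otimes> inv d" using carr p_M by (simp add: d' m_assoc)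
    then have p_D: "p \<in> D" using md by simp
    have "r m \<otimes>\<^bsub>H\<^esub> x d = r m' \<otimes>\<^bsub>H\<^esub> (r p \<otimes>\<^bsub>H\<^esub> x d)"
      using md p_M by (simp add: m r_mult r_closed x_closed H.m_assoc)
    also have "\<dots> = r m' \<otimes>\<^bsub>H\<^esub> x d'"
      using md p_M p_D by (simp add: d' x_mult agree)
    finally show ?thesis .
  qed
  define g where "g k = (SOME v. \<exists>m\<in>M. \<exists>d\<in>D. k = m \<otimes> d \<and> v = r m \<otimes>\<^bsub>H\<^esub> x d)" for k
  have g: "g (m \<otimes> d) = r m \<otimes>\<^bsub>H\<^esub> x d" if "m \<in> M" "d \<in> D" for m d
    unfolding g_def
  proof (rule some_equality)
    show "\<exists>m'\<in>M. \<exists>d'\<in>D. m \<otimes> d = m' \<otimes> d' \<and> r m \<otimes>\<^bsub>H\<^esub> x d = r m' \<otimes>\<^bsub>H\<^esub> x d'"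
      using that by blast
  next
    fix v assume "\<exists>m'\<in>M. \<exists>d'\<in>D. m \<otimes> d = m' \<otimes> d' \<and> v = r m' \<otimes>\<^bsub>H\<^esub> x d'"
    then obtain m' d' where "m' \<in> M" "d' \<in> D" "m \<otimes> d = m' \<otimes> d'" "v = r m' \<otimes>\<^bsub>H\<^esub> x d'"
      by blast
    with that show "v = r m \<otimes>\<^bsub>H\<^esub> x d" by (simp add: well_defined[of m d m' d'])
  qed
  have "g \<in> hom (G\<lparr>carrier := M <#> D\<rparr>) H"
  proof (rule homI)
    fix k assume "k \<in> carrier (G\<lparr>carrier := M <#> D\<rparr>)"
    then show "g k \<in> carrier H" by (auto simp: set_mult_def g r_closed x_closed)
  next
    fix k k' assume "k \<in> carrier (G\<lparr>carrier := M <#> D\<rparr>)" "k' \<in> carrier (G\<lparr>carrier := M <#> D\<rparr>)"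
    then obtain m d m' d' where k: "m \<in> M" "d \<in> D" "m' \<in> M" "d' \<in> D" "k = m \<otimes> d" "k' = m' \<otimes> d'"
      by (auto simp: set_mult_def)
    have "k \<otimes> k' = (m \<otimes> m') \<otimes> (d \<otimes> d')" using k by (simp add: m_ac)
    then have "g (k \<otimes> k') = g k \<otimes>\<^bsub>H\<^esub> g k'"
      using k by (simp add: g r_mult x_mult r_closed x_closed H.m_ac)
    then show "g (k \<otimes>\<^bsub>G\<lparr>carrier := M <#> D\<rparr>\<^esub> k') = g k \<otimes>\<^bsub>H\<^esub> g k'" by simp
  qed
  then show ?thesis using g that by blast
qed

lemma (in comm_group) generate_insert:
  assumes "c \<in> carrier G" "S \<subseteq> carrier G"
  shows "generate G (insert c S) = {c [^] k \<otimes> w | (k::int) w. w \<in> generate G S}" (is "_ = ?R")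
proof
  interpret S: subgroup "generate G S" G using assms by (simp add: generate_is_subgroup)
  show "?R \<subseteq> generate G (insert c S)"
  proof clarify
    fix k :: int and w assume w: "w \<in> generate G S"
    have "subgroup (generate G (insert c S)) G" using assms by (simp add: generate_is_subgroup)
    moreover have "w \<in> generate G (insert c S)" using w mono_generate[of S "insert c S"] by auto
    moreover have "c \<in> generate G (insert c S)" by (simp add: generate.incl)
    ultimately show "c [^] k \<otimes> w \<in> generate G (insert c S)"
      by (simp add: subgroup.m_closed subgroup_int_pow_closed)
  qed
  have "subgroup ?R G"
  proof (rule subgroupI)
    show "?R \<subseteq> carrier G" using assms by auto
    show "?R \<noteq> {}" by (auto intro: S.one_closed)
  next
    fix a assume "a \<in> ?R"
    then obtain k :: int and w where a: "a = c [^] k \<otimes> w" "w \<in> generate G S" by auto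
    have "inv a = c [^] (- k) \<otimes> inv w"
      using a assms by (simp add: inv_mult int_pow_neg)
    then show "inv a \<in> ?R" using a(2) by blast
  next
    fix a b assume "a \<in> ?R" "b \<in> ?R"
    then obtain k l :: int and w v where ab: "a = c [^] k \<otimes> w" "w \<in> generate G S"
      "b = c [^] l \<otimes> v" "v \<in> generate G S" by auto
    have "a \<otimes> b = c [^] (k + l) \<otimes> (w \<otimes> v)"
      using ab assms by (simp add: int_pow_mult m_ac)
    then show "a \<otimes> b \<in> ?R" using ab by blast
  qed
  moreover have "insert c S \<subseteq> ?R"
  proof -
    have "c = c [^] (1::int) \<otimes> \<one>" using assms by simp
    moreover have "s = c [^] (0::int) \<otimes> s" if "s \<in> S" for s using assms that by auto
    ultimately show ?thesis using S.one_closed generate.incl[of _ S G] by blast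
  qed
  ultimately show "generate G (insert c S) \<subseteq> ?R" by (rule generate_subgroup_incl[rotated])
qed

text \<open>Multiplication by \<open>w\<close> is undone by multiplication by its inverse, so the
  inclusion \<open>*\<close> used twice gives equality. This allows a generator to be altered modulo
  the span of the others.\<close>

lemma (in comm_group) generate_insert_mult:
  assumes "c \<in> carrier G" "V \<subseteq> carrier G" "w \<in> generate G V"
  shows "generate G (insert (c \<otimes> w) V) = generate G (insert c V)"
proof -
  have *: "generate G (insert (c \<otimes> w) V) \<subseteq> generate G (insert c V)"
    if cw: "c \<in> carrier G" "w \<in> generate G V" for c w
  proof (rule generate_subgroup_incl)
    show sub: "subgroup (generate G (insert c V)) G" using cw assms by (simp add: generate_is_subgroup)
    have "w \<in> generate G (insert c V)" using cw mono_generate[of V "insert c V"] by auto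
    then have "c \<otimes> w \<in> generate G (insert c V)"
      by (metis generate.eng generate.incl insertI1)
    then show "insert (c \<otimes> w) V \<subseteq> generate G (insert c V)"
      by (auto intro: generate.incl)
  qed
  have w: "w \<in> carrier G" using assms generate_in_carrier by blast
  have "generate G (insert ((c \<otimes> w) \<otimes> inv w) V) \<subseteq> generate G (insert (c \<otimes> w) V)"
    using assms w by (intro *) (auto intro: generate_m_inv_closed)
  then show ?thesis using * assms w by (auto simp: m_assoc)
qed

text \<open>Rado's argument: among all generating systems \<open>c, V\<close> modulo \<open>M\<close> of bounded size, take one with the
  smallest \<open>n > 0\<close> such that \<open>c\<^sup>n\<close> lies in the span of \<open>M \<union> V\<close>. By minimality \<open>n\<close> divides the
  exponents in this relation, so \<open>c\<close> can be modified to have \<open>c\<^sup>n \<in> M\<close>, and purity makes it torsion.\<close>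

lemma (in comm_group) pure_split_generator:
  assumes pure: "pure_subgroup M G" and "finite V\<^sub>0" "V\<^sub>0 \<subseteq> carrier G" "c\<^sub>0 \<in> carrier G"
  obtains t V where "finite V" "card V \<le> card V\<^sub>0" "V \<subseteq> carrier G" "t \<in> carrier G"
    and "generate G (insert t (M \<union> V)) = generate G (insert c\<^sub>0 (M \<union> V\<^sub>0))"
    and "\<And>k::int. t [^] k \<in> generate G (M \<union> V) \<Longrightarrow> t [^] k = \<one>"
proof -
  interpret M: subgroup M G using pure by (simp add: pure_subgroup_def)
  define K where "K = generate G (insert c\<^sub>0 (M \<union> V\<^sub>0))"
  define P where "P n c V \<longleftrightarrow> finite V \<and> card V \<le> card V\<^sub>0 \<and> V \<subseteq> carrier G \<and> c \<in> carrier G \<and>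
    generate G (insert c (M \<union> V)) = K \<and> c [^] int n \<in> generate G (M \<union> V)" for n c V
  show ?thesis
  proof (cases "\<exists>n>0. \<exists>c V. P n c V")
    \<comment> \<open>No admissible system has a positive power of its generator in the span of the
      rest, so the original system is already split.\<close>
    case False
    have "c\<^sub>0 [^] k = \<one>" if k: "c\<^sub>0 [^] k \<in> generate G (M \<union> V\<^sub>0)" for k :: int
    proof (cases "k = 0")
      case False
      have "subgroup (generate G (M \<union> V\<^sub>0)) G"
        using assms M.subset by (intro generate_is_subgroup) auto
      from subgroup_int_pow_closed[OF this k, of "sgn k"]
      have "c\<^sub>0 [^] int (nat \<bar>k\<bar>) \<in> generate G (M \<union> V\<^sub>0)"
        using assms by (simp add: int_pow_pow flip: abs_sgn)
      then have "P (nat \<bar>k\<bar>) c\<^sub>0 V\<^sub>0" using assms by (simp add: P_def K_def)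
      moreover have "nat \<bar>k\<bar> > 0" using False by simp
      ultimately show ?thesis using \<open>\<not> (\<exists>n>0. \<exists>c V. P n c V)\<close> by blast
    qed simp
    then show ?thesis using that[of V\<^sub>0 c\<^sub>0] assms by simp
  next
    case True
    define n where "n = (LEAST n. n > 0 \<and> (\<exists>c V. P n c V))"
    have "n > 0 \<and> (\<exists>c V. P n c V)" unfolding n_def using True by (rule LeastI_ex)
    then obtain c V where n: "n > 0" and P: "P n c V" by blast
    have least: "r = 0" if "0 \<le> r" "r < int n" "P (nat r) c' V'" for r c' V'
    proof (rule ccontr)
      assume "r \<noteq> 0"
      then have "n \<le> nat r" unfolding n_def using that by (intro Least_le) auto
      then show False using that by simp
    qed
    have finV: "finite V" and cardV: "card V \<le> card V\<^sub>0" and V: "V \<subseteq> carrier G" and c: "c \<in> carrier G"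
      using P by (auto simp: P_def)
    have carr: "M \<union> V \<subseteq> carrier G" using V M.subset by auto
    \<comment> \<open>The elements of \<open>V\<close> are removed from the relation one at a time;
      \<open>V\<close> itself stays fixed and only the distinguished generator changes.\<close>
    have reduce: "\<exists>c'. c' \<in> carrier G \<and> generate G (insert c' (M \<union> V)) = K \<and>
        c' [^] int n \<in> generate G (M \<union> (V - U))" if "finite U" "U \<subseteq> V" for U
      using that
    proof (induction U)
      case empty
      then show ?case using P by (auto simp: P_def)
    next
      case (insert v U)
      then obtain c' where c': "c' \<in> carrier G" "generate G (insert c' (M \<union> V)) = K"
        "c' [^] int n \<in> generate G (M \<union> (V - U))" by auto
      let ?W = "M \<union> (V - insert v U)"
      have v: "v \<in> V" "v \<in> carrier G" and W: "?W \<subseteq> carrier G"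
        using insert.prems carr by auto
      have "M \<union> (V - U) = insert v ?W" using insert by auto
      then obtain e :: int and w where e: "c' [^] int n = v [^] e \<otimes> w" and w: "w \<in> generate G ?W"
        using c'(3) generate_insert[OF v(2) W] by auto
      have w_carr: "w \<in> carrier G" using w W generate_in_carrier by blast
      define q r where "q = e div int n" and "r = e mod int n"
      have r: "0 \<le> r" "r < int n" "e = q * int n + r" using n by (auto simp: q_def r_def)
      define d where "d = c' \<otimes> v [^] (- q)"
      have d: "d \<in> carrier G" using c' v by (simp add: d_def)
      have "v [^] (- q) \<in> generate G (M \<union> V)"
        by (rule subgroup_int_pow_closed[OF generate_is_subgroup[OF carr]])
          (use v in \<open>auto intro: generate.incl\<close>)
      then have gen_d: "generate G (insert d (M \<union> V)) = K"
        unfolding d_def using c' carr by (simp add: generate_insert_mult)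
      have "d [^] int n = c' [^] int n \<otimes> v [^] (- q * int n)"
        using c' v by (simp add: d_def int_pow_distrib int_pow_pow)
      also have "\<dots> = (v [^] e \<otimes> v [^] (- q * int n)) \<otimes> w"
        using v w_carr by (simp add: e m_ac)
      also have "v [^] e \<otimes> v [^] (- q * int n) = v [^] r"
        using v r(3) by (simp add: int_pow_mult[symmetric])
      finally have dn: "d [^] int n = v [^] r \<otimes> w" .
      \<comment> \<open>By \<open>dn\<close>, the \<open>r\<close>-th power of \<open>v\<close> lies
        in the span of the rest once \<open>d\<close> takes the place of \<open>v\<close> among the
        other generators. Thus \<open>v\<close> is a competitor with exponent \<open>r < n\<close>,
        and minimality of \<open>n\<close> forces \<open>r = 0\<close>.\<close>
      have "r = 0"
      proof (rule least[OF r(1,2)])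
        let ?V' = "insert d (V - {v})"
        have V'c: "M \<union> ?V' \<subseteq> carrier G" using d carr by auto
        have eq: "insert v (M \<union> ?V') = insert d (M \<union> V)" using v by auto
        have "card ?V' \<le> Suc (card (V - {v}))" using finV by (simp add: card_insert_if)
        also have "\<dots> = card V" using finV v by (simp only: card_Suc_Diff1)
        finally have "card ?V' \<le> card V\<^sub>0" using cardV by simp
        interpret S: subgroup "generate G (M \<union> ?V')" G using V'c by (rule generate_is_subgroup)
        have "w \<in> generate G (M \<union> ?V')" using w mono_generate[of ?W "M \<union> ?V'"] by auto
        moreover have "d \<in> generate G (M \<union> ?V')" by (rule generate.incl) auto
        then have "d [^] int n \<in> generate G (M \<union> ?V')"
          by (rule subgroup_int_pow_closed[OF S.subgroup_axioms])
        moreover have "v [^] r = d [^] int n \<otimes> inv w"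
          using v w_carr by (simp add: dn m_assoc)
        ultimately have "v [^] r \<in> generate G (M \<union> ?V')" by (metis S.m_closed S.m_inv_closed)
        then show "P (nat r) v ?V'"
          unfolding P_def using eq gen_d \<open>card ?V' \<le> card V\<^sub>0\<close> V'c v r(1) finV by simp
      qed
      then have "d [^] int n \<in> generate G ?W" using dn w w_carr by simp
      then show ?case using d gen_d by blast
    qed
    obtain c' where c': "c' \<in> carrier G" "generate G (insert c' (M \<union> V)) = K" "c' [^] int n \<in> generate G M"
      using reduce[OF finV order_refl] by auto
    have "c' [^] n \<in> M"
      using c'(3) generate_subgroup_incl[OF order_refl M.subgroup_axioms] by (auto simp: int_pow_int)
    \<comment> \<open>Purity replaces the root \<open>c'\<close> of an element of \<open>M\<close>
      by a root \<open>m\<close> inside \<open>M\<close>; the quotient \<open>t\<close> is then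
      killed by \<open>n\<close>.\<close>
    then obtain m where m: "m \<in> M" "m [^] n = c' [^] n"
      using pure n c' unfolding pure_subgroup_def by blast
    define t where "t = c' \<otimes> inv m"
    have t: "t \<in> carrier G" using c' m by (simp add: t_def)
    have "inv m \<in> generate G (M \<union> V)" using m by (auto intro: generate.inv)
    then have gen_t: "generate G (insert t (M \<union> V)) = K"
      unfolding t_def using c' carr by (simp add: generate_insert_mult)
    have tn: "t [^] int n = \<one>"
      using c' m by (simp add: t_def int_pow_int nat_pow_distrib nat_pow_inv)
    have "t [^] k = \<one>" if k: "t [^] k \<in> generate G (M \<union> V)" for k :: int
    proof -
      define r where "r = k mod int n"
      have r: "0 \<le> r" "r < int n" using n by (auto simp: r_def)
      have "t [^] k = t [^] (int n * (k div int n) + r)" by (simp add: r_def)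
      also have "\<dots> = t [^] r"
        using t by (simp only: int_pow_mult int_pow_pow[symmetric] tn int_pow_one) simp
      finally have tk: "t [^] k = t [^] r" .
      have "r = 0"
        by (rule least[OF r, of t V]) (use r k gen_t t V finV cardV in \<open>simp add: P_def tk\<close>)
      then show ?thesis by (simp add: tk)
    qed
    then show ?thesis using that[of V t] finV cardV V t gen_t by (simp add: K_def)
  qed
qed

section \<open>Finite retractions and countable extensions of pure subgroups\<close>

text \<open>By \<open>pure_split_generator\<close> one generator may be taken to be some
  \<open>t\<close> whose powers meet the span of \<open>M\<close> and the other generators
  trivially; a retraction of that span extends by the trivial map on the powers of
  \<open>t\<close>.\<close>

lemma (in comm_group) pure_retract:
  assumes pure: "pure_subgroup M G" and "finite F" "F \<subseteq> carrier G"
  shows "\<exists>s\<in>hom (G\<lparr>carrier := generate G (M \<union> F)\<rparr>) (G\<lparr>carrier := M\<rparr>). \<forall>m\<in>M. s m = m"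
proof -
  interpret M: subgroup M G using pure by (simp add: pure_subgroup_def)
  have comm: "comm_group (G\<lparr>carrier := M\<rparr>)"
    by (rule group.group_comm_groupI[OF subgroup_imp_group[OF M.subgroup_axioms]]) (auto simp: m_comm)
  \<comment> \<open>The induction runs over a bound for \<open>card F\<close>, because the new
    generators \<open>W\<close> need not come from \<open>F\<close>.\<close>
  have "\<exists>s\<in>hom (G\<lparr>carrier := generate G (M \<union> F)\<rparr>) (G\<lparr>carrier := M\<rparr>). \<forall>m\<in>M. s m = m"
    if "finite F" "F \<subseteq> carrier G" "card F \<le> n" for n F
    using that
  proof (induction n arbitrary: F)
    case 0
    have "generate G M = M"
      using generate_subgroup_incl[OF order_refl M.subgroup_axioms] by (auto intro: generate.incl)
    then have "id \<in> hom (G\<lparr>carrier := generate G (M \<union> F)\<rparr>) (G\<lparr>carrier := M\<rparr>)"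
      using 0 by (simp add: hom_def)
    then show ?case by (metis id_apply)
  next
    case (Suc n)
    show ?case
    proof (cases "F = {}")
      case True
      then show ?thesis using Suc.IH[of F] by simp
    next
      case False
      then obtain c V where F: "F = insert c V" "c \<notin> V" by (meson ex_in_conv mk_disjoint_insert)
      have Vprops: "finite V" "V \<subseteq> carrier G" "c \<in> carrier G" "card V \<le> n" using Suc.prems F by auto
      obtain t W where W: "finite W" "card W \<le> card V" "W \<subseteq> carrier G" and t: "t \<in> carrier G"
        and gen: "generate G (insert t (M \<union> W)) = generate G (insert c (M \<union> V))"
        and split: "\<And>k::int. t [^] k \<in> generate G (M \<union> W) \<Longrightarrow> t [^] k = \<one>"
        using pure_split_generator[OF pure Vprops(1-3)] by metis
      obtain s where s: "s \<in> hom (G\<lparr>carrier := generate G (M \<union> W)\<rparr>) (G\<lparr>carrier := M\<rparr>)"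
        and s_id: "\<forall>m\<in>M. s m = m"
        using Suc.IH[of W] W Vprops by auto
      have MW: "M \<union> W \<subseteq> carrier G" using W M.subset by auto
      have one: "s \<one> = \<one>" using s_id by simp
      have agree: "s z = \<one>" if "z \<in> generate G (M \<union> W)" "z \<in> generate G {t}" for z
        using that split one by (auto simp: generate_pow[OF t])
      have triv: "(\<lambda>_. \<one>) \<in> hom (G\<lparr>carrier := generate G {t}\<rparr>) (G\<lparr>carrier := M\<rparr>)"
        by (simp add: hom_def)
      obtain g where g: "g \<in> hom (G\<lparr>carrier := generate G (M \<union> W) <#> generate G {t}\<rparr>) (G\<lparr>carrier := M\<rparr>)"
        and g_eq: "\<And>m d. m \<in> generate G (M \<union> W) \<Longrightarrow> d \<in> generate G {t} \<Longrightarrow> g (m \<otimes> d) = s m \<otimes> \<one>"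
        by (rule hom_glue[OF generate_is_subgroup[OF MW] generate_is_subgroup[of "{t}"] comm s triv])
          (use t agree in auto)
      have "generate G (M \<union> W) <#> generate G {t} = generate G (M \<union> F)"
      proof -
        have swap: "h \<otimes> t [^] k = t [^] k \<otimes> h" if "h \<in> generate G (M \<union> W)" for h and k :: int
          using t generate_in_carrier[OF MW that] by (simp add: m_comm)
        have "generate G (M \<union> W) <#> generate G {t} = {h \<otimes> t [^] k | (k::int) h. h \<in> generate G (M \<union> W)}"
          unfolding generate_pow[OF t] set_mult_def by blast
        also have "\<dots> = generate G (insert t (M \<union> W))"
          unfolding generate_insert[OF t MW] using swap by metis
        finally have "generate G (M \<union> W) <#> generate G {t} = generate G (insert t (M \<union> W))" .
        then show ?thesis using gen F by simp
      qed
      moreover have "g m = m" if "m \<in> M" for m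
        using g_eq[of m \<one>] s_id that by (auto intro: generate.incl generate.one)
      ultimately show ?thesis using g by metis
    qed
  qed
  then show ?thesis using assms by blast
qed

text \<open>\<open>D\<close> is the closure of \<open>b\<close> under quotients and under one chosen
  root modulo \<open>M\<close> for each element and exponent, which keeps it countable.\<close>

lemma (in comm_group) countable_pure_extension:
  assumes pure: "pure_subgroup M G" and b: "b \<in> carrier G"
  obtains D where "subgroup D G" "countable D" "b \<in> D" "pure_subgroup (M <#> D) G"
proof -
  interpret M: subgroup M G using pure by (simp add: pure_subgroup_def)
  \<comment> \<open>The chosen root depends on \<open>d\<close> and \<open>n\<close> only, not on
    the element of \<open>M\<close>, so the size of \<open>M\<close> does not enter the
    closure.\<close>
  define w where "w d n = (SOME y. y \<in> carrier G \<and>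
      ((\<exists>z\<in>carrier G. \<exists>m\<in>M. z [^] n = m \<otimes> d) \<longrightarrow> (\<exists>m\<in>M. y [^] n = m \<otimes> d)))" for d and n :: nat
  have w: "w d n \<in> carrier G \<and>
      ((\<exists>z\<in>carrier G. \<exists>m\<in>M. z [^] n = m \<otimes> d) \<longrightarrow> (\<exists>m\<in>M. w d n [^] n = m \<otimes> d))" for d n
    unfolding w_def by (rule someI_ex) blast
  then have w_carr: "w d n \<in> carrier G" for d n by blast
  define step where "step S = S \<union> (\<lambda>(x, y). x \<otimes> inv y) ` (S \<times> S) \<union> (\<lambda>(d, n). w d n) ` (S \<times> UNIV)" for S
  define E where "E i = (step ^^ i) {b}" for i
  define D where "D = (\<Union>i. E i)"
  have E0: "E 0 = {b}" and ESuc: "E (Suc i) = step (E i)" for i by (simp_all add: E_def)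
  have E_mono: "E i \<subseteq> E j" if "i \<le> j" for i j
    using that by (induction rule: dec_induct) (auto simp: ESuc step_def)
  have E_carr: "E i \<subseteq> carrier G" for i
    using b w_carr by (induction i) (auto simp: E0 ESuc step_def)
  have "countable (E i)" for i
    by (induction i) (auto simp: E0 ESuc step_def)
  then have countable: "countable D" by (simp add: D_def)
  have D_carr: "D \<subseteq> carrier G" using E_carr by (auto simp: D_def)
  have bD: "b \<in> D" using E0 by (auto simp: D_def)
  have D_div: "x \<otimes> inv y \<in> D" if xy: "x \<in> D" "y \<in> D" for x y
  proof -
    obtain i j where "x \<in> E i" "y \<in> E j" using xy by (auto simp: D_def)
    then have "x \<in> E (max i j)" "y \<in> E (max i j)"
      using E_mono[of i "max i j"] E_mono[of j "max i j"] by auto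
    then have "x \<otimes> inv y \<in> E (Suc (max i j))" by (force simp: ESuc step_def)
    then show ?thesis by (auto simp: D_def)
  qed
  have D_w: "w d n \<in> D" if d: "d \<in> D" for d n
  proof -
    obtain i where "d \<in> E i" using d by (auto simp: D_def)
    then have "w d n \<in> E (Suc i)" by (force simp: ESuc step_def)
    then show ?thesis by (auto simp: D_def)
  qed
  have one_D: "\<one> \<in> D" using D_div[OF bD bD] b by simp
  have D_inv: "inv x \<in> D" if "x \<in> D" for x using D_div[OF one_D that] that D_carr by auto
  have D: "subgroup D G"
  proof (rule subgroupI)
    fix x y assume xy: "x \<in> D" "y \<in> D"
    have "x \<otimes> inv (inv y) \<in> D" using xy by (intro D_div D_inv)
    then show "x \<otimes> y \<in> D" using xy D_carr by auto
  qed (use D_carr one_D D_inv in auto)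
  interpret D: subgroup D G by (rule D)
  have "pure_subgroup (M <#> D) G"
    unfolding pure_subgroup_def
  proof (intro conjI allI impI ballI)
    show "subgroup (M <#> D) G" by (rule mult_subgroups[OF M.subgroup_axioms D])
  next
    fix n :: nat and s
    assume n: "0 < n" and "s \<in> M <#> D" and "\<exists>y\<in>carrier G. y [^] n = s"
    then obtain m d y where s: "m \<in> M" "d \<in> D" "s = m \<otimes> d" "y \<in> carrier G" "y [^] n = m \<otimes> d"
      by (auto simp: set_mult_def)
    then obtain m' where m': "m' \<in> M" "w d n [^] n = m' \<otimes> d" using w by blast
    let ?v = "w d n"
    have carr: "m \<in> carrier G" "m' \<in> carrier G" "d \<in> carrier G" "?v \<in> carrier G"
      using s m' w_carr by auto
    \<comment> \<open>The given root \<open>y\<close> and the chosen root are roots of elements of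
      the same coset of \<open>M\<close>, so their quotient is a root of an element of
      \<open>M\<close>; purity of \<open>M\<close> then yields the correction
      \<open>u\<close>.\<close>
    have "(y \<otimes> inv ?v) [^] n = (m \<otimes> d) \<otimes> inv (m' \<otimes> d)"
      using s m' carr by (simp add: nat_pow_distrib nat_pow_inv)
    also have "\<dots> = m \<otimes> inv m'"
      using carr by (simp add: inv_mult m_assoc) (simp add: m_comm[of "inv m'"] m_assoc[symmetric])
    finally have "(y \<otimes> inv ?v) [^] n = m \<otimes> inv m'" .
    moreover have "y \<otimes> inv ?v \<in> carrier G" "m \<otimes> inv m' \<in> M" using s m' carr by auto
    ultimately obtain u where u: "u \<in> M" "u [^] n = m \<otimes> inv m'"
      using pure n unfolding pure_subgroup_def by blast
    have "(u \<otimes> ?v) [^] n = (m \<otimes> inv m') \<otimes> (m' \<otimes> d)"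
      using u carr m' by (simp add: nat_pow_distrib)
    also have "\<dots> = s" using carr s by (simp add: m_assoc) (simp add: m_assoc[symmetric])
    finally have "(u \<otimes> ?v) [^] n = s" .
    moreover have "u \<otimes> ?v \<in> M <#> D" using u D_w[OF s(2)] by (auto simp: set_mult_def)
    ultimately show "\<exists>y\<in>M <#> D. y [^] n = s" by blast
  qed
  then show ?thesis using that D countable bD by blast
qed

lemma (in group) subgroup_Union_chain:
  assumes "\<C> \<noteq> {}" and chain: "\<And>C D. C \<in> \<C> \<Longrightarrow> D \<in> \<C> \<Longrightarrow> C \<subseteq> D \<or> D \<subseteq> C"
    and sub: "\<And>C. C \<in> \<C> \<Longrightarrow> subgroup C G"
  shows "subgroup (\<Union>\<C>) G"
proof (rule subgroupI)
  show "\<Union>\<C> \<subseteq> carrier G" using sub subgroup.subset by blast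
  obtain C where "C \<in> \<C>" using \<open>\<C> \<noteq> {}\<close> by blast
  then show "\<Union>\<C> \<noteq> {}" using subgroup.one_closed[OF sub] by blast
  show "inv x \<in> \<Union>\<C>" if "x \<in> \<Union>\<C>" for x
    using that subgroup.m_inv_closed[OF sub] by blast
  show "x \<otimes> y \<in> \<Union>\<C>" if "x \<in> \<Union>\<C>" "y \<in> \<Union>\<C>" for x y
  proof -
    obtain C D where CD: "C \<in> \<C>" "D \<in> \<C>" "x \<in> C" "y \<in> D"
      using \<open>x \<in> \<Union>\<C>\<close> \<open>y \<in> \<Union>\<C>\<close> by blast
    then obtain E where "E \<in> \<C>" "x \<in> E" "y \<in> E" using chain[OF CD(1,2)] by blast
    then show ?thesis using subgroup.m_closed[OF sub] by blast
  qed
qed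

subsection \<open>Quotients with a diagonal limit\<close>

text \<open>\<open>\<Lambda>\<close> plays the role of a limit on \<open>L\<^sup>\<nat>\<close> with values in \<open>H = L / ker \<pi>\<close>. It need not kill sequences in
  \<open>ker \<pi>\<close>, so it does not descend to \<open>H\<^sup>\<nat>\<close>: this is what \<open>locally_split\<close> has to compensate.\<close>

locale diagonal_quotient = H: comm_group H
  for H :: "('h, 'm) monoid_scheme" (structure) +
  fixes L :: "'l::ab_group_add set" and \<pi> :: "'l \<Rightarrow> 'h" and \<Lambda> :: "(nat \<Rightarrow> 'l) \<Rightarrow> 'h"
  assumes zero_closed: "0 \<in> L"
    and diff_closed: "\<And>x y. x \<in> L \<Longrightarrow> y \<in> L \<Longrightarrow> x - y \<in> L"
    and pi_image: "\<pi> ` L = carrier H"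
    and pi_add: "\<And>x y. x \<in> L \<Longrightarrow> y \<in> L \<Longrightarrow> \<pi> (x + y) = \<pi> x \<otimes> \<pi> y"
    and locally_split: "\<And>F. finite F \<Longrightarrow> F \<subseteq> {x \<in> L. \<pi> x = \<one>} \<Longrightarrow>
      \<exists>\<phi>. \<phi> ` L \<subseteq> {x \<in> L. \<pi> x = \<one>} \<and> (\<forall>x\<in>L. \<forall>y\<in>L. \<phi> (x - y) = \<phi> x - \<phi> y) \<and> (\<forall>x\<in>F. \<phi> x = x)"
    and Lambda_closed: "\<And>y. range y \<subseteq> L \<Longrightarrow> \<Lambda> y \<in> carrier H"
    and Lambda_add: "\<And>y z. range y \<subseteq> L \<Longrightarrow> range z \<subseteq> L \<Longrightarrow> \<Lambda> (\<lambda>n. y n + z n) = \<Lambda> y \<otimes> \<Lambda> z"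
    and Lambda_eventually_const: "\<And>y n\<^sub>0 a. range y \<subseteq> L \<Longrightarrow> a \<in> L \<Longrightarrow> (\<And>n. n\<^sub>0 \<le> n \<Longrightarrow> y n = a) \<Longrightarrow> \<Lambda> y = \<pi> a"
begin

lemma add_closed: "x \<in> L \<Longrightarrow> y \<in> L \<Longrightarrow> x + y \<in> L"
  using diff_closed[of x "0 - y"] diff_closed[of 0 y] zero_closed by simp

lemma pi_closed: "x \<in> L \<Longrightarrow> \<pi> x \<in> carrier H"
  using pi_image by auto

lemma pi_diff: "x \<in> L \<Longrightarrow> y \<in> L \<Longrightarrow> \<pi> (x - y) = \<pi> x \<otimes> inv \<pi> y"
  using pi_add[of "x - y" y] by (simp add: diff_closed pi_closed H.inv_solve_right)

section \<open>Extending a homomorphism over a countable subgroup\<close>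

text \<open>The homomorphism is built on \<open>D\<close> alone: agreement with \<open>r\<close> on
  the intersection with \<open>M\<close> is exactly what \<open>hom_glue\<close> asks for.\<close>

lemma extend_hom_countable:
  fixes G :: "('g, 'n) monoid_scheme"
  assumes G: "comm_group G" and pure: "pure_subgroup M G"
    and r: "r \<in> hom (G\<lparr>carrier := M\<rparr>) H"
    and D: "subgroup D G" and countable: "countable D"
  obtains x where "x \<in> hom (G\<lparr>carrier := D\<rparr>) H" "\<And>d. d \<in> M \<Longrightarrow> d \<in> D \<Longrightarrow> x d = r d"
proof -
  interpret G: comm_group G by (rule G)
  interpret M: subgroup M G using pure by (simp add: pure_subgroup_def)
  interpret D: subgroup D G by (rule D)
  define F where "F j = from_nat_into D ` {..j}" for j :: nat
  have D_nonempty: "D \<noteq> {}" using D.one_closed by blast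
  have F_D: "F j \<subseteq> D" for j using from_nat_into[OF D_nonempty] by (auto simp: F_def)
  have F_mono: "F i \<subseteq> F j" if "i \<le> j" for i j using that by (auto simp: F_def)
  have F_ex: "\<exists>i. d \<in> F i" if "d \<in> D" for d
    using from_nat_into_surj[OF countable that] by (auto simp: F_def)
  have F_fin: "finite (F j)" for j by (simp add: F_def)
  have "\<exists>s\<in>hom (G\<lparr>carrier := generate G (M \<union> F j)\<rparr>) (G\<lparr>carrier := M\<rparr>). \<forall>m\<in>M. s m = m" for j
    using F_D D.subset by (intro G.pure_retract[OF pure F_fin]) auto
  then obtain s where s: "\<And>j. s j \<in> hom (G\<lparr>carrier := generate G (M \<union> F j)\<rparr>) (G\<lparr>carrier := M\<rparr>)"
    and s_id: "\<And>j m. m \<in> M \<Longrightarrow> s j m = m" by metis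
  \<comment> \<open>The finite extensions \<open>h j\<close> are chosen separately and need not
    agree with one another outside \<open>M\<close>; on \<open>M\<close> each of them is
    \<open>r\<close>.\<close>
  define h where "h j v = r (s j v)" for j v
  have s_M: "s j v \<in> M" if "v \<in> F j" for j v
    using s[of j] that by (auto simp: hom_def intro: generate.incl)
  have h_closed: "h j v \<in> carrier H" if "v \<in> F j" for j v
    using r s_M[OF that] by (auto simp: h_def hom_def)
  have h_mult: "h j (u \<otimes>\<^bsub>G\<^esub> v) = h j u \<otimes> h j v" if "u \<in> F j" "v \<in> F j" for j u v
  proof -
    have "s j (u \<otimes>\<^bsub>G\<^esub> v) = s j u \<otimes>\<^bsub>G\<^esub> s j v"
      using s[of j] that by (auto simp: hom_def intro: generate.incl)
    then show ?thesis using r s_M that by (auto simp: h_def hom_def)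
  qed
  have h_M: "h j v = r v" if "v \<in> M" for j v using that by (simp add: h_def s_id)

  define lifts where "lifts j Y \<longleftrightarrow> (\<forall>v\<in>F j. Y v \<in> L \<and> \<pi> (Y v) = h j v)" for j and Y :: "'g \<Rightarrow> 'l"
  define defect where "defect Y u v = Y u + Y v - Y (u \<otimes>\<^bsub>G\<^esub> v)" for Y :: "'g \<Rightarrow> 'l" and u v
  define pairs where "pairs j = {(u, v). u \<in> F j \<and> v \<in> F j \<and> u \<otimes>\<^bsub>G\<^esub> v \<in> F j}" for j
  define compat where "compat j Y Y' \<longleftrightarrow> (\<forall>(u, v)\<in>pairs j. defect Y' u v = defect Y u v) \<and>
    (\<forall>v\<in>M \<inter> F j. Y' v = Y v)" for j and Y Y' :: "'g \<Rightarrow> 'l"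
  have lift: "\<exists>Y. lifts j Y" for j
  proof -
    have "\<forall>v\<in>F j. \<exists>y. y \<in> L \<and> \<pi> y = h j v" using h_closed pi_image by (metis imageE)
    then show ?thesis unfolding lifts_def by (rule bchoice)
  qed
  have defect_L: "defect Y u v \<in> L" and pi_defect: "\<pi> (defect Y u v) = \<one>"
    if "lifts j Y" "(u, v) \<in> pairs j" for j Y u v
  proof -
    have Y: "Y u \<in> L" "Y v \<in> L" "Y (u \<otimes>\<^bsub>G\<^esub> v) \<in> L" using that by (auto simp: lifts_def pairs_def)
    then show "defect Y u v \<in> L" by (simp add: defect_def add_closed diff_closed)
    have "\<pi> (defect Y u v) = h j u \<otimes> h j v \<otimes> inv h j (u \<otimes>\<^bsub>G\<^esub> v)"
      using that Y by (auto simp: lifts_def pairs_def defect_def pi_diff pi_add add_closed)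
    then show "\<pi> (defect Y u v) = \<one>"
      using that h_closed by (auto simp: h_mult pairs_def)
  qed
  txt \<open>The defects of two lifts over the same finite set differ by elements of \<open>ker \<pi>\<close>. Splitting
    off finitely many of these, the next lift can be chosen without changing the old defects.\<close>
  have "\<exists>Y'. lifts (Suc j) Y' \<and> compat j Y Y'" if Y: "lifts j Y" for j Y
  proof -
    obtain Y1 where Y1: "lifts (Suc j) Y1" using lift by blast
    have FF: "F j \<subseteq> F (Suc j)" by (rule F_mono) simp
    have pairsS: "pairs j \<subseteq> pairs (Suc j)" using FF by (auto simp: pairs_def)
    define z where "z v = Y1 v - Y v" for v
    \<comment> \<open>\<open>E\<close> records how \<open>Y1\<close> departs from \<open>Y\<close>
      in the data to be preserved: the defects of old pairs, and the values on \<open>M\<close>,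
      where both are lifts of \<open>r\<close>. All of these lie in the kernel of
      \<open>\<pi>\<close>.\<close>
    define E where "E = (\<lambda>(u, v). defect z u v) ` pairs j \<union> z ` (M \<inter> F j)"
    have defect_z: "defect z u v = defect Y1 u v - defect Y u v" for u v
      by (simp add: defect_def z_def algebra_simps)
    have Y_L: "Y v \<in> L" "Y1 v \<in> L" if "v \<in> F j" for v
      using that Y Y1 FF by (auto simp: lifts_def)
    have z_L: "z v \<in> L" if "v \<in> F j" for v using Y_L[OF that] by (simp add: z_def diff_closed)
    have "pairs j \<subseteq> F j \<times> F j" by (auto simp: pairs_def)
    then have "finite (pairs j)" using F_fin finite_subset by blast
    then have E_fin: "finite E" using F_fin by (simp add: E_def)
    have E_sub: "E \<subseteq> {x \<in> L. \<pi> x = \<one>}"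
    proof -
      have "defect z u v \<in> L \<and> \<pi> (defect z u v) = \<one>" if uv: "(u, v) \<in> pairs j" for u v
        unfolding defect_z using defect_L pi_defect Y Y1 uv pairsS
        by (simp add: diff_closed pi_diff subset_iff)
      moreover have "z v \<in> L \<and> \<pi> (z v) = \<one>" if v: "v \<in> M" "v \<in> F j" for v
      proof -
        have "\<pi> (Y1 v) = r v" "\<pi> (Y v) = r v" using v Y Y1 FF h_M by (auto simp: lifts_def)
        moreover have "r v \<in> carrier H" using v r by (auto simp: hom_def)
        ultimately show ?thesis using Y_L v z_L by (simp add: z_def pi_diff)
      qed
      ultimately show ?thesis by (auto simp: E_def)
    qed
    obtain \<phi> where \<phi>: "\<phi> ` L \<subseteq> {x \<in> L. \<pi> x = \<one>}"
      and "\<forall>x\<in>L. \<forall>y\<in>L. \<phi> (x - y) = \<phi> x - \<phi> y" and "\<forall>x\<in>E. \<phi> x = x"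
      using locally_split[OF E_fin E_sub] by blast
    then have \<phi>_diff: "\<phi> (x - y) = \<phi> x - \<phi> y" if "x \<in> L" "y \<in> L" for x y using that by blast
    have \<phi>_E: "\<phi> x = x" if "x \<in> E" for x using that \<open>\<forall>x\<in>E. \<phi> x = x\<close> by blast
    have \<phi>_add: "\<phi> (x + y) = \<phi> x + \<phi> y" if "x \<in> L" "y \<in> L" for x y
      using \<phi>_diff[of "x + y" y] that by (simp add: add_closed)
    \<comment> \<open>Subtracting kernel elements leaves a lift. As \<open>\<phi>\<close> is
      additive and fixes \<open>E\<close>, the correction cancels exactly the changes recorded in
      \<open>E\<close>.\<close>
    define Y' where "Y' v = (if v \<in> F j then Y1 v - \<phi> (z v) else Y1 v)" for v
    have "lifts (Suc j) Y'"
      unfolding lifts_def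
    proof
      fix v assume v: "v \<in> F (Suc j)"
      then have Y1v: "Y1 v \<in> L" "\<pi> (Y1 v) = h (Suc j) v" using Y1 by (auto simp: lifts_def)
      show "Y' v \<in> L \<and> \<pi> (Y' v) = h (Suc j) v"
      proof (cases "v \<in> F j")
        case True
        then have "\<phi> (z v) \<in> L" "\<pi> (\<phi> (z v)) = \<one>" using z_L \<phi> by auto
        then show ?thesis using True Y1v h_closed[OF v] by (simp add: Y'_def diff_closed pi_diff)
      qed (use Y1v in \<open>simp add: Y'_def\<close>)
    qed
    moreover have "compat j Y Y'"
      unfolding compat_def
    proof (intro conjI ballI, clarify)
      fix u v assume uv: "(u, v) \<in> pairs j"
      then have F: "u \<in> F j" "v \<in> F j" "u \<otimes>\<^bsub>G\<^esub> v \<in> F j" by (auto simp: pairs_def)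
      have "\<phi> (defect z u v) = defect z u v" using uv by (intro \<phi>_E) (auto simp: E_def)
      moreover have "\<phi> (defect z u v) = \<phi> (z u) + \<phi> (z v) - \<phi> (z (u \<otimes>\<^bsub>G\<^esub> v))"
        using z_L F by (simp add: defect_def \<phi>_add \<phi>_diff add_closed)
      ultimately have "\<phi> (z u) + \<phi> (z v) - \<phi> (z (u \<otimes>\<^bsub>G\<^esub> v)) = defect z u v" by metis
      moreover have "defect Y' u v = defect Y1 u v - (\<phi> (z u) + \<phi> (z v) - \<phi> (z (u \<otimes>\<^bsub>G\<^esub> v)))"
        using F by (simp add: defect_def Y'_def algebra_simps)
      ultimately show "defect Y' u v = defect Y u v" by (simp add: defect_z[of u v])
    next
      fix v assume "v \<in> M \<inter> F j"
      then have "\<phi> (z v) = z v" by (intro \<phi>_E) (auto simp: E_def)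
      then show "Y' v = Y v" using \<open>v \<in> M \<inter> F j\<close> by (simp add: Y'_def z_def)
    qed
    ultimately show ?thesis by blast
  qed
  then obtain Y where Y: "\<And>j. lifts j (Y j)" and compat: "\<And>j. compat j (Y j) (Y (Suc j))"
    using dependent_nat_choice[of lifts compat] lift by metis
  \<comment> \<open>The default 0 only keeps the sequence inside \<open>L\<close>: for
    \<open>v\<close> in \<open>D\<close> it occurs at finitely many places, since the
    \<open>F j\<close> increase and exhaust \<open>D\<close>.\<close>
  define c where "c v j = (if v \<in> F j then Y j v else 0)" for v j
  have c_L: "range (c v) \<subseteq> L" for v using Y zero_closed by (auto simp: c_def lifts_def)
  define x where "x v = \<Lambda> (c v)" for v
  have "x \<in> hom (G\<lparr>carrier := D\<rparr>) H"
  proof (rule homI)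
    fix u assume "u \<in> carrier (G\<lparr>carrier := D\<rparr>)"
    show "x u \<in> carrier H" unfolding x_def by (rule Lambda_closed[OF c_L])
  next
    fix u v assume "u \<in> carrier (G\<lparr>carrier := D\<rparr>)" "v \<in> carrier (G\<lparr>carrier := D\<rparr>)"
    then have uv: "u \<in> D" "v \<in> D" "u \<otimes>\<^bsub>G\<^esub> v \<in> D" by auto
    then obtain i1 i2 i3 where "u \<in> F i1" "v \<in> F i2" "u \<otimes>\<^bsub>G\<^esub> v \<in> F i3" using F_ex by metis
    then obtain k where "u \<in> F k" "v \<in> F k" "u \<otimes>\<^bsub>G\<^esub> v \<in> F k"
      using F_mono[of i1 "max i1 (max i2 i3)"] F_mono[of i2 "max i1 (max i2 i3)"]
        F_mono[of i3 "max i1 (max i2 i3)"] by (meson max.cobounded1 max.cobounded2 max.coboundedI2 subsetD)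
    then have pairs: "(u, v) \<in> pairs n" if "k \<le> n" for n
      using F_mono[OF that] by (auto simp: pairs_def)
    \<comment> \<open>The failure of additivity is eventually one fixed defect. It lies in the
      kernel of \<open>\<pi>\<close>, so \<open>\<Lambda>\<close> sends the sequence to the neutral
      element.\<close>
    define \<delta> where "\<delta> n = c u n + c v n - c (u \<otimes>\<^bsub>G\<^esub> v) n" for n
    have \<delta>_L: "range \<delta> \<subseteq> L"
      using c_L by (auto simp: \<delta>_def image_subset_iff intro!: add_closed diff_closed)
    have stable: "defect (Y n) u v = defect (Y k) u v" if "k \<le> n" for n
      using that
    proof (induction rule: dec_induct)
      case (step n)
      then show ?case using compat[of n] pairs[of n] by (auto simp: compat_def)
    qed simp
    have \<delta>_const: "\<delta> n = defect (Y k) u v" if "k \<le> n" for n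
      unfolding stable[OF that, symmetric]
      using pairs[OF that] by (simp add: \<delta>_def c_def defect_def pairs_def)
    have "\<Lambda> \<delta> = \<pi> (defect (Y k) u v)"
      by (rule Lambda_eventually_const[OF \<delta>_L defect_L[OF Y pairs[OF order_refl]] \<delta>_const])
    also have "\<dots> = \<one>" by (rule pi_defect[OF Y pairs[OF order_refl]])
    finally have "\<Lambda> \<delta> = \<one>" .
    have "x u \<otimes> x v = \<Lambda> (\<lambda>n. c u n + c v n)"
      unfolding x_def by (rule Lambda_add[symmetric, OF c_L c_L])
    also have "\<dots> = \<Lambda> (\<lambda>n. \<delta> n + c (u \<otimes>\<^bsub>G\<^esub> v) n)" by (simp add: \<delta>_def)
    also have "\<dots> = x (u \<otimes>\<^bsub>G\<^esub> v)"
      unfolding x_def Lambda_add[OF \<delta>_L c_L] \<open>\<Lambda> \<delta> = \<one>\<close> using Lambda_closed[OF c_L] by simp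
    finally show "x (u \<otimes>\<^bsub>G\<lparr>carrier := D\<rparr>\<^esub> v) = x u \<otimes> x v" by simp
  qed
  moreover have "x d = r d" if d: "d \<in> M" "d \<in> D" for d
  proof -
    obtain k where k: "d \<in> F k" using F_ex d by blast
    have Yd: "Y n d = Y k d" if "k \<le> n" for n
      using that
    proof (induction rule: dec_induct)
      case (step n)
      then show ?case using compat[of n] d k F_mono[of k n] by (auto simp: compat_def)
    qed simp
    have c_const: "c d n = Y k d" if "k \<le> n" for n
      using Yd[OF that] F_mono[OF that] k by (auto simp: c_def)
    have Yk: "Y k d \<in> L" "\<pi> (Y k d) = r d" using Y[of k] k d h_M by (auto simp: lifts_def)
    have "x d = \<pi> (Y k d)"
      unfolding x_def by (rule Lambda_eventually_const[OF c_L Yk(1) c_const])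
    then show ?thesis using Yk by simp
  qed
  ultimately show ?thesis using that by blast
qed

section \<open>Complements by Zorn's lemma\<close>

text \<open>A partial retraction onto \<open>A\<close> is recorded by its kernel \<open>C\<close>,
  so that Zorn's lemma applies to subgroups ordered by inclusion; a maximal kernel turns out to be a
  complement.\<close>

theorem alg_compact: "alg_compact H TYPE('b)"
  unfolding alg_compact_def
proof (intro conjI allI impI)
  show "comm_group H" by (rule H.comm_group_axioms)
next
  fix B :: "'b monoid" and h
  assume *: "comm_group B \<and> h \<in> hom H B \<and> inj_on h (carrier H) \<and> pure_subgroup (h ` carrier H) B"
  then have B: "comm_group B" and h: "h \<in> hom H B" and inj: "inj_on h (carrier H)"
    and pure: "pure_subgroup (h ` carrier H) B" by auto
  interpret B: comm_group B by (rule B)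
  define A where "A = h ` carrier H"
  interpret A: subgroup A B using pure by (simp add: pure_subgroup_def A_def)
  interpret h: group_hom H B h
    using h by unfold_locales
  define \<C> where "\<C> = {C. subgroup C B \<and> A \<inter> C = {\<one>\<^bsub>B\<^esub>} \<and> pure_subgroup (A <#>\<^bsub>B\<^esub> C) B}"
  have "A <#>\<^bsub>B\<^esub> {\<one>\<^bsub>B\<^esub>} = A" using A.subset by (force simp: set_mult_def)
  then have "{\<one>\<^bsub>B\<^esub>} \<in> \<C>"
    using pure B.triv_subgroup by (auto simp: \<C>_def A_def[symmetric])
  then have nonempty: "\<C> \<noteq> {}" by auto
  have union: "\<Union>\<K> \<in> \<C>" if K: "\<K> \<noteq> {}" "subset.chain \<C> \<K>" for \<K>
  proof -
    have K\<C>: "C \<in> \<C>" if "C \<in> \<K>" for C using K that by (auto simp: subset.chain_def)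
    have lin: "C \<subseteq> D \<or> D \<subseteq> C" if "C \<in> \<K>" "D \<in> \<K>" for C D
      using K that by (auto simp: subset.chain_def)
    have sub: "subgroup (\<Union>\<K>) B"
      by (rule B.subgroup_Union_chain[OF K(1) lin]) (use K\<C> \<C>_def in auto)
    have "A \<inter> C = {\<one>\<^bsub>B\<^esub>}" if "C \<in> \<K>" for C using K\<C>[OF that] by (simp add: \<C>_def)
    then have triv: "A \<inter> \<Union>\<K> = {\<one>\<^bsub>B\<^esub>}" using K(1) by blast
    have "pure_subgroup (A <#>\<^bsub>B\<^esub> \<Union>\<K>) B"
      unfolding pure_subgroup_def
    proof (intro conjI allI impI ballI)
      show "subgroup (A <#>\<^bsub>B\<^esub> \<Union>\<K>) B" by (rule B.mult_subgroups[OF A.subgroup_axioms sub])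
    next
      fix n :: nat and s
      assume n: "0 < n" and s: "s \<in> A <#>\<^bsub>B\<^esub> \<Union>\<K>" and y: "\<exists>y\<in>carrier B. y [^]\<^bsub>B\<^esub> n = s"
      \<comment> \<open>An element of the product with the union already lies in the product with a
        single member of the chain, whose purity supplies the root.\<close>
      then obtain C where C: "C \<in> \<K>" "s \<in> A <#>\<^bsub>B\<^esub> C" by (auto simp: set_mult_def)
      then have "pure_subgroup (A <#>\<^bsub>B\<^esub> C) B" using K\<C> by (simp add: \<C>_def)
      then have "\<exists>y\<in>A <#>\<^bsub>B\<^esub> C. y [^]\<^bsub>B\<^esub> n = s"
        using n C(2) y unfolding pure_subgroup_def by blast
      moreover have "A <#>\<^bsub>B\<^esub> C \<subseteq> A <#>\<^bsub>B\<^esub> \<Union>\<K>" using C(1) by (auto simp: set_mult_def)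
      ultimately show "\<exists>y\<in>A <#>\<^bsub>B\<^esub> \<Union>\<K>. y [^]\<^bsub>B\<^esub> n = s" by blast
    qed
    then show ?thesis using sub triv by (simp add: \<C>_def)
  qed
  obtain C where C: "C \<in> \<C>" and maximal: "\<And>C'. C' \<in> \<C> \<Longrightarrow> C \<subseteq> C' \<Longrightarrow> C' = C"
    using subset_Zorn_nonempty[OF nonempty union] by blast
  interpret C: subgroup C B using C by (simp add: \<C>_def)
  define M where "M = A <#>\<^bsub>B\<^esub> C"
  have AC: "A \<inter> C = {\<one>\<^bsub>B\<^esub>}" and M: "pure_subgroup M B" using C by (auto simp: \<C>_def M_def)
  interpret M: subgroup M B using M by (simp add: pure_subgroup_def)
  have "M = carrier B"
  proof (rule ccontr)
    assume "M \<noteq> carrier B"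
    then obtain b where b: "b \<in> carrier B" "b \<notin> M" using M.subset by blast
    obtain D where D: "subgroup D B" "countable D" "b \<in> D" and K: "pure_subgroup (M <#>\<^bsub>B\<^esub> D) B"
      using B.countable_pure_extension[OF M b(1)] by blast
    interpret D: subgroup D B by (rule D)
    define p where "p = inv_into (carrier H) h"
    have p_h: "p (h y) = y" if "y \<in> carrier H" for y using inj that by (simp add: p_def)
    have p_hom: "p \<in> hom (B\<lparr>carrier := A\<rparr>) H"
      by (rule homI) (auto simp: A_def p_h simp flip: h.hom_mult)
    have triv: "(\<lambda>_. \<one>) \<in> hom (B\<lparr>carrier := C\<rparr>) H" by (simp add: hom_def)
    have p_one: "p \<one>\<^bsub>B\<^esub> = \<one>" using p_h[of \<one>] by simp
    have p_C: "p z = \<one>" if "z \<in> A" "z \<in> C" for z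
    proof -
      have "z = \<one>\<^bsub>B\<^esub>" using that AC by blast
      then show ?thesis using p_one by simp
    qed
    \<comment> \<open>\<open>r\<close> is the projection of \<open>M\<close> onto \<open>A\<close>
      along \<open>C\<close>, transported to \<open>H\<close> by the inverse \<open>p\<close> of
      \<open>h\<close>.\<close>
    obtain r where r: "r \<in> hom (B\<lparr>carrier := M\<rparr>) H"
      and r_eq: "\<And>a c. a \<in> A \<Longrightarrow> c \<in> C \<Longrightarrow> r (a \<otimes>\<^bsub>B\<^esub> c) = p a \<otimes> \<one>"
      using B.hom_glue[OF A.subgroup_axioms C.subgroup_axioms H.comm_group_axioms p_hom triv p_C]
      unfolding M_def by blast
    obtain x where x: "x \<in> hom (B\<lparr>carrier := D\<rparr>) H" and x_eq: "\<And>d. d \<in> M \<Longrightarrow> d \<in> D \<Longrightarrow> x d = r d"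
      using extend_hom_countable[OF B M r D(1,2)] by blast
    define N where "N = M <#>\<^bsub>B\<^esub> D"
    interpret N: subgroup N B using K by (simp add: pure_subgroup_def N_def)
    obtain g where g: "g \<in> hom (B\<lparr>carrier := N\<rparr>) H"
      and g_eq: "\<And>m d. m \<in> M \<Longrightarrow> d \<in> D \<Longrightarrow> g (m \<otimes>\<^bsub>B\<^esub> d) = r m \<otimes> x d"
      using B.hom_glue[OF M.subgroup_axioms D(1) H.comm_group_axioms r x x_eq[symmetric]]
      unfolding N_def by blast
    have g_mult: "g (u \<otimes>\<^bsub>B\<^esub> v) = g u \<otimes> g v" if "u \<in> N" "v \<in> N" for u v
      using g that by (auto simp: hom_def)
    have g_closed: "g u \<in> carrier H" if "u \<in> N" for u using g that by (auto simp: hom_def)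
    have AM: "a \<in> M" if "a \<in> A" for a
    proof -
      have "a \<otimes>\<^bsub>B\<^esub> \<one>\<^bsub>B\<^esub> \<in> M" unfolding M_def set_mult_def using that C.one_closed by blast
      then show ?thesis using that by simp
    qed
    have CM: "c \<in> M" if "c \<in> C" for c
    proof -
      have "\<one>\<^bsub>B\<^esub> \<otimes>\<^bsub>B\<^esub> c \<in> M" unfolding M_def set_mult_def using that A.one_closed by blast
      then show ?thesis using that by simp
    qed
    have MN: "m \<in> N" if "m \<in> M" for m
    proof -
      have "m \<otimes>\<^bsub>B\<^esub> \<one>\<^bsub>B\<^esub> \<in> N" unfolding N_def set_mult_def using that D.one_closed by blast
      then show ?thesis using that by simp
    qed
    have r_A: "r (h y) = y" if "y \<in> carrier H" for y
      using r_eq[of "h y" "\<one>\<^bsub>B\<^esub>"] that by (simp add: A_def p_h)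
    have r_C: "r c = \<one>" if "c \<in> C" for c
      using r_eq[OF A.one_closed that] that by (simp add: p_one)
    have x_one: "x \<one>\<^bsub>B\<^esub> = \<one>" using x_eq[OF M.one_closed D.one_closed] r_C[OF C.one_closed] by simp
    have g_M: "g m = r m" if "m \<in> M" for m
    proof -
      have "r m \<in> carrier H" using r that by (auto simp: hom_def)
      then show ?thesis using g_eq[OF that D.one_closed] that by (simp add: x_one)
    qed
    have g_one: "g \<one>\<^bsub>B\<^esub> = \<one>" using g_M[OF M.one_closed] r_C[OF C.one_closed] by simp
    \<comment> \<open>The kernel of the extended retraction contains \<open>C\<close> and
      complements \<open>A\<close> in \<open>N\<close>. Maximality gives \<open>C' = C\<close>,
      hence \<open>N = M\<close>, which contradicts the choice of \<open>b\<close>.\<close>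
    define C' where "C' = {u \<in> N. g u = \<one>}"
    have C'_sub: "subgroup C' B"
    proof (rule B.subgroupI)
      show "C' \<subseteq> carrier B" using N.subset by (auto simp: C'_def)
      show "C' \<noteq> {}" using g_one N.one_closed unfolding C'_def by blast
      show "u \<otimes>\<^bsub>B\<^esub> v \<in> C'" if "u \<in> C'" "v \<in> C'" for u v
        using that by (simp add: C'_def g_mult)
      show "inv\<^bsub>B\<^esub> u \<in> C'" if "u \<in> C'" for u
      proof -
        have u: "u \<in> N" "g u = \<one>" using that by (auto simp: C'_def)
        then have "g u \<otimes> g (inv\<^bsub>B\<^esub> u) = \<one>"
          using g_mult[of u "inv\<^bsub>B\<^esub> u"] g_one by simp
        then show ?thesis using u g_closed by (simp add: C'_def)
      qed
    qed
    have C_C': "C \<subseteq> C'" using CM MN g_M r_C by (auto simp: C'_def)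
    have triv': "A \<inter> C' = {\<one>\<^bsub>B\<^esub>}"
    proof -
      have "a = \<one>\<^bsub>B\<^esub>" if a: "a \<in> A" "a \<in> C'" for a
      proof -
        obtain y where y: "y \<in> carrier H" "a = h y" using a by (auto simp: A_def)
        then have "y = \<one>" using a AM g_M r_A by (simp add: C'_def)
        then show ?thesis using y by simp
      qed
      moreover have "\<one>\<^bsub>B\<^esub> \<in> C'" using C'_sub by (rule subgroup.one_closed)
      ultimately show ?thesis by auto
    qed
    have AC': "A <#>\<^bsub>B\<^esub> C' = N"
    proof
      show "A <#>\<^bsub>B\<^esub> C' \<subseteq> N" using AM MN by (auto simp: set_mult_def C'_def)
      show "N \<subseteq> A <#>\<^bsub>B\<^esub> C'"
      proof
        fix u assume u: "u \<in> N"
        define a where "a = h (g u)"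
        have a: "a \<in> A" "a \<in> N" using g_closed[OF u] AM MN by (auto simp: a_def A_def)
        have ga: "g a = g u" using g_M[OF AM[OF a(1)]] r_A[OF g_closed[OF u]] by (simp add: a_def)
        have "g a \<otimes> g (inv\<^bsub>B\<^esub> a \<otimes>\<^bsub>B\<^esub> u) = g u"
          using a u by (simp flip: g_mult B.m_assoc)
        then have "g (inv\<^bsub>B\<^esub> a \<otimes>\<^bsub>B\<^esub> u) = \<one>"
          using ga a u g_closed by (simp add: H.r_cancel_one')
        then have "inv\<^bsub>B\<^esub> a \<otimes>\<^bsub>B\<^esub> u \<in> C'" using a u by (simp add: C'_def)
        moreover have "u = a \<otimes>\<^bsub>B\<^esub> (inv\<^bsub>B\<^esub> a \<otimes>\<^bsub>B\<^esub> u)" using a u by (simp flip: B.m_assoc)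
        ultimately show "u \<in> A <#>\<^bsub>B\<^esub> C'" using a(1) unfolding set_mult_def by blast
      qed
    qed
    have "C' \<in> \<C>" using C'_sub triv' K by (simp add: \<C>_def AC' N_def)
    then have "C' = C" using C_C' by (rule maximal)
    then have "N = M" using AC' by (simp add: M_def)
    moreover have "\<one>\<^bsub>B\<^esub> \<otimes>\<^bsub>B\<^esub> b \<in> N" unfolding N_def set_mult_def using D(3) M.one_closed by blast
    ultimately show False using b by simp
  qed
  then show "\<exists>C. subgroup C B \<and> h ` carrier H \<inter> C = {\<one>\<^bsub>B\<^esub>} \<and> h ` carrier H <#>\<^bsub>B\<^esub> C = carrier B"
    using AC C.subgroup_axioms unfolding M_def A_def by blast
qed

end

subsection \<open>The cokernel of the comparison map\<close>

lemma push_base [simp]: "push k b' g b' = 0"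
  by (simp add: push_def)

text \<open>Summing over any finite set that contains the support makes functions with different
  supports comparable.\<close>

lemma push_eq_sum:
  assumes "finite A" "{x. g x \<noteq> 0} \<subseteq> A" "y \<noteq> b'"
  shows "push k b' g y = (\<Sum>x\<in>{x \<in> A. k x = y}. g x)"
  unfolding push_def using assms by (auto intro!: sum.mono_neutral_left)

lemma push_nonzeroD:
  assumes "push k b' g y \<noteq> 0"
  shows "y \<noteq> b'" "\<exists>x. g x \<noteq> 0 \<and> k x = y"
proof -
  show "y \<noteq> b'" using assms by auto
  show "\<exists>x. g x \<noteq> 0 \<and> k x = y"
  proof (rule ccontr)
    assume "\<nexists>x. g x \<noteq> 0 \<and> k x = y"
    then have empty: "{x. g x \<noteq> 0 \<and> k x = y} = {}" by blast
    show False using assms unfolding push_def empty by (simp split: if_splits)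
  qed
qed

lemma push_cong: "(\<And>x. g x \<noteq> 0 \<Longrightarrow> k x = k' x) \<Longrightarrow> push k b' g = push k' b' g"
  unfolding push_def by (intro ext if_cong refl sum.cong) auto

lemma push_ident:
  assumes "\<And>x. g x \<noteq> 0 \<Longrightarrow> k x = x" "g b' = 0"
  shows "push k b' g = g"
proof
  fix y
  have "{x. g x \<noteq> 0 \<and> k x = y} = (if g y = 0 then {} else {y})" using assms(1) by auto
  then show "push k b' g y = g y" using assms(2) by (auto simp: push_def)
qed

lemma finite_support_push:
  assumes "finite {x. g x \<noteq> 0}"
  shows "finite {y. push k b' g y \<noteq> 0}"
proof (rule finite_subset)
  show "{y. push k b' g y \<noteq> 0} \<subseteq> k ` {x. g x \<noteq> 0}" using push_nonzeroD(2) by fastforce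
qed (use assms in simp)

text \<open>The inner push-forward discards what lies over \<open>b1\<close>; because
  \<open>h\<close> maps \<open>b1\<close> to \<open>b2\<close>, the composite discards it as well.
  Elsewhere the sum is regrouped by the fibres of \<open>k\<close>.\<close>

lemma push_comp:
  assumes fin: "finite {x. g x \<noteq> 0}" and base: "h b1 = b2"
  shows "push h b2 (push k b1 g) = push (\<lambda>x. h (k x)) b2 g"
proof
  fix y
  let ?A = "{x. g x \<noteq> 0}"
  show "push h b2 (push k b1 g) y = push (\<lambda>x. h (k x)) b2 g y"
  proof (cases "y = b2")
    case False
    let ?S = "{x \<in> ?A. h (k x) = y}"
    have sub: "{z. push k b1 g z \<noteq> 0} \<subseteq> k ` ?A" using push_nonzeroD(2) by fastforce
    have "push h b2 (push k b1 g) y = (\<Sum>z\<in>{z \<in> k ` ?A. h z = y}. push k b1 g z)"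
      using fin sub False by (intro push_eq_sum) auto
    also have "\<dots> = (\<Sum>z\<in>k ` ?S. \<Sum>x\<in>{x \<in> ?S. k x = z}. g x)"
    proof (rule sum.cong)
      show "{z \<in> k ` ?A. h z = y} = k ` ?S" by auto
    next
      fix z assume "z \<in> k ` ?S"
      then have z: "h z = y" "z \<noteq> b1" using base False by auto
      then have "push k b1 g z = (\<Sum>x\<in>{x \<in> ?A. k x = z}. g x)"
        using fin by (intro push_eq_sum) auto
      also have "{x \<in> ?A. k x = z} = {x \<in> ?S. k x = z}" using z by auto
      finally show "push k b1 g z = (\<Sum>x\<in>{x \<in> ?S. k x = z}. g x)" .
    qed
    also have "\<dots> = (\<Sum>x\<in>?S. g x)" using fin by (intro sum.image_gen[symmetric]) auto
    also have "\<dots> = push (\<lambda>x. h (k x)) b2 g y"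
      using fin False by (intro push_eq_sum[symmetric]) auto
    finally show ?thesis .
  qed simp
qed

lemma push_diff:
  assumes "finite {x. g x \<noteq> 0}" "finite {x. g' x \<noteq> 0}"
  shows "push k b' (g - g') = push k b' g - push k b' g'"
proof
  fix y
  let ?A = "{x. g x \<noteq> 0} \<union> {x. g' x \<noteq> 0}"
  have "finite ?A" using assms by simp
  moreover have "{x. (g - g') x \<noteq> 0} \<subseteq> ?A" by auto
  ultimately show "push k b' (g - g') y = (push k b' g - push k b' g') y"
    by (cases "y = b'") (simp_all add: push_eq_sum[of ?A] sum_subtractf)
qed

lemma smash_finite: "g \<in> smash Y b' \<Longrightarrow> finite {x. g x \<noteq> 0}"
  by (simp add: smash_def)

lemma smash_nonzeroD: "g \<in> smash Y b' \<Longrightarrow> g x \<noteq> 0 \<Longrightarrow> x \<in> Y \<and> x \<noteq> b'"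
  by (auto simp: smash_def)

lemma smash_diff:
  assumes "g \<in> smash Y b'" "g' \<in> smash Y b'"
  shows "g - g' \<in> smash Y b'"
proof -
  have "{x. (g - g') x \<noteq> 0} \<subseteq> {x. g x \<noteq> 0} \<union> {x. g' x \<noteq> 0}" by auto
  then have "finite {x. (g - g') x \<noteq> 0}" using assms by (auto simp: smash_def intro: finite_subset)
  then show ?thesis using assms by (auto simp: smash_def)
qed

lemma push_smash:
  assumes "g \<in> smash Y b0" "\<And>x. x \<in> Y \<Longrightarrow> k x \<in> Z"
  shows "push k b1 g \<in> smash Z b1"
proof -
  have "push k b1 g y = 0" if "y \<notin> Z \<or> y = b1" for y
    using that push_nonzeroD[of k b1 g y] smash_nonzeroD[OF assms(1)] assms(2) by blast
  then show ?thesis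
    using finite_support_push[OF smash_finite[OF assms(1)]] by (auto simp: smash_def)
qed

locale mittag_leffler_diagram =
  fixes P :: "'t::order \<Rightarrow> 'x set" and b :: "'t \<Rightarrow> 'x" and f :: "'t \<Rightarrow> 't \<Rightarrow> 'x \<Rightarrow> 'x"
    and A :: "'a::ab_group_add itself"  \<comment> \<open>only fixes the coefficient type\<close>
  assumes countable: "countable (UNIV :: 't set)"
    and directed: "directed_poset TYPE('t)"
    and diagram: "pointed_diagram P b f"
    and stabilizes: "mittag_leffler P f"
begin

lemma base_in: "b t \<in> P t"
  and map_in: "s \<le> t \<Longrightarrow> x \<in> P t \<Longrightarrow> f t s x \<in> P s"
  and map_base: "s \<le> t \<Longrightarrow> f t s (b t) = b s"
  and map_refl: "x \<in> P t \<Longrightarrow> f t t x = x"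
  and map_comp: "r \<le> s \<Longrightarrow> s \<le> t \<Longrightarrow> x \<in> P t \<Longrightarrow> f s r (f t s x) = f t r x"
  using diagram by (simp_all add: pointed_diagram_def image_subset_iff)

lemma upper_bound: "\<exists>r. s \<le> r \<and> t \<le> (r::'t)"
  using directed by (simp add: directed_poset_def)

lemma finite_upper_bound:
  assumes "finite S"
  shows "\<exists>r. \<forall>t\<in>S. t \<le> (r::'t)"
  using assms
proof induction
  case (insert t S)
  then obtain r where "\<forall>t\<in>S. t \<le> r" by blast
  then show ?case using upper_bound[of t r] by (auto intro: order_trans)
qed simp

section \<open>Cofinal sequences, stable images and threads\<close>

text \<open>Each new term lies above its predecessor and above the next entry of an enumeration of
  the indices. The prescribed start serves to build threads through a given point over
  \<open>t0\<close>.\<close>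

lemma cofinal_sequence:
  obtains c :: "nat \<Rightarrow> 't" where "c 0 = t0" "incseq c" "\<And>t. \<exists>n. t \<le> c n"
proof -
  let ?u = "from_nat_into (UNIV :: 't set)"
  have "\<exists>c. \<forall>n. (n = 0 \<longrightarrow> c n = t0) \<and> c n \<le> c (Suc n) \<and> ?u n \<le> c (Suc n)"
    using dependent_nat_choice[of "\<lambda>n x. n = 0 \<longrightarrow> x = t0" "\<lambda>n x y. x \<le> y \<and> ?u n \<le> y"] upper_bound
    by simp
  then obtain c where c: "c 0 = t0" "\<And>n. c n \<le> c (Suc n)" "\<And>n. ?u n \<le> c (Suc n)" by metis
  have "\<exists>n. t \<le> c n" for t
    using from_nat_into_surj[OF countable, of t] c(3) by auto
  then show ?thesis using that[of c] c by (simp add: incseq_Suc_iff)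
qed

text \<open>These are the universal images; under the Mittag-Leffler condition each of them is the
  image of a single transition map.\<close>

definition stable :: "'t \<Rightarrow> 'x set" where
  "stable t = (\<Inter>s\<in>{t..}. f s t ` P s)"

text \<open>Take \<open>r\<close> beyond which the images in \<open>P t\<close> no longer shrink. A
  preimage of \<open>x\<close> in \<open>P r\<close> exists by stability of \<open>x\<close>, and
  its image in \<open>P t\<close> is a stable lift.\<close>

lemma stable_lift_step:
  assumes x: "x \<in> stable s" and st: "s \<le> t"
  shows "\<exists>y. y \<in> stable t \<and> f t s y = x"
proof -
  obtain r where r: "t \<le> r" and r_stable: "\<And>q. r \<le> q \<Longrightarrow> f r t ` P r = f q t ` P q"
    using stabilizes unfolding mittag_leffler_def by blast
  have "x \<in> f r s ` P r" using x r st by (auto simp: stable_def)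
  then obtain z where z: "z \<in> P r" "x = f r s z" by blast
  have "f r t z \<in> f q t ` P q" if q: "t \<le> q" for q
  proof -
    obtain p where p: "q \<le> p" "r \<le> p" using upper_bound by blast
    then obtain w where w: "w \<in> P p" "f r t z = f p t w" using r_stable[OF p(2)] z by blast
    have "f p t w = f q t (f p q w)" using w p q by (simp add: map_comp)
    then show ?thesis using w p map_in by auto
  qed
  then have "f r t z \<in> stable t" by (auto simp: stable_def)
  moreover have "f t s (f r t z) = x" using z r st by (simp add: map_comp)
  ultimately show ?thesis by blast
qed

lemma stable_sub: "stable t \<subseteq> P t"
  using map_refl by (force simp: stable_def)

text \<open>Lift step by step along a cofinal sequence starting at \<open>t0\<close>, and obtain the
  remaining coordinates by projection.\<close>

lemma stable_lift:
  assumes x: "x \<in> stable t0"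
  obtains \<xi> where "\<xi> \<in> lim_pset P f" "\<xi> t0 = x"
proof -
  obtain c where c: "c 0 = t0" "incseq c" "\<And>t. \<exists>n. t \<le> c n" using cofinal_sequence by blast
  have "\<exists>z. \<forall>n. (z n \<in> stable (c n) \<and> (n = 0 \<longrightarrow> z n = x)) \<and> f (c (Suc n)) (c n) (z (Suc n)) = z n"
  proof (rule dependent_nat_choice)
    show "\<exists>z. z \<in> stable (c 0) \<and> (0 = (0::nat) \<longrightarrow> z = x)" using x c by simp
  next
    fix z and n :: nat assume "z \<in> stable (c n) \<and> (n = 0 \<longrightarrow> z = x)"
    then show "\<exists>y. (y \<in> stable (c (Suc n)) \<and> (Suc n = 0 \<longrightarrow> y = x)) \<and> f (c (Suc n)) (c n) y = z"
      using stable_lift_step[of z "c n" "c (Suc n)"] incseq_SucD[OF c(2)] by simp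
  qed
  then obtain z where z: "\<And>n. z n \<in> stable (c n)" "z 0 = x"
    and z_Suc: "\<And>n. f (c (Suc n)) (c n) (z (Suc n)) = z n" by metis
  have zP: "z n \<in> P (c n)" for n using z stable_sub by blast
  have z_le: "f (c m) (c n) (z m) = z n" if "n \<le> m" for m n
    using that
  proof (induction rule: dec_induct)
    case base
    then show ?case using zP map_refl by simp
  next
    case (step m)
    have "f (c (Suc m)) (c n) (z (Suc m)) = f (c m) (c n) (f (c (Suc m)) (c m) (z (Suc m)))"
      using incseqD[OF c(2)] step zP by (simp add: map_comp)
    then show ?case using step z_Suc by simp
  qed
  define N where "N t = (LEAST n. t \<le> c n)" for t
  have N: "t \<le> c (N t)" for t unfolding N_def using c(3) by (rule LeastI_ex)
  define \<xi> where "\<xi> t = f (c (N t)) t (z (N t))" for t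
  \<comment> \<open>Any term of the sequence above \<open>t\<close> gives the same coordinate, which
    is what compatibility of the coordinates rests on.\<close>
  have \<xi>: "\<xi> t = f (c n) t (z n)" if t: "t \<le> c n" for t n
  proof -
    have "N t \<le> n" unfolding N_def using t by (rule Least_le)
    then have "f (c n) t (z n) = f (c (N t)) t (f (c n) (c (N t)) (z n))"
      using N[of t] incseqD[OF c(2)] zP by (simp add: map_comp)
    then show ?thesis using z_le[OF \<open>N t \<le> n\<close>] by (simp add: \<xi>_def)
  qed
  have "\<xi> \<in> lim_pset P f"
    unfolding lim_pset_def
  proof (intro CollectI conjI allI impI)
    show "\<xi> t \<in> P t" for t unfolding \<xi>_def using N zP by (rule map_in)
    show "f t s (\<xi> t) = \<xi> s" if "s \<le> t" for t s
      using that N[of t] zP \<xi>[of s "N t"] by (simp add: \<xi>_def map_comp)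
  qed
  moreover have "\<xi> t0 = x"
    using \<xi>[of t0 0] c(1) z zP[of 0] map_refl[of x t0] by simp
  ultimately show ?thesis by (rule that)
qed

section \<open>The limit of the \<open>X \<and> A\<close> and the image of
  \<open>\<rho>\<close>\<close>

abbreviation X_lim :: "('t \<Rightarrow> 'x) set" where
  "X_lim \<equiv> lim_pset P f"

abbreviation L :: "('t \<Rightarrow> 'x \<Rightarrow> 'a) set" where
  "L \<equiv> lim_smash P b f"

abbreviation N :: "('t \<Rightarrow> 'x \<Rightarrow> 'a) set" where
  "N \<equiv> rho_image P b f"

lemma base_in_lim: "b \<in> X_lim"
  using base_in map_base by (simp add: lim_pset_def)

lemma L_smash: "G \<in> L \<Longrightarrow> G t \<in> smash (P t) (b t)"
  and L_push: "G \<in> L \<Longrightarrow> s \<le> t \<Longrightarrow> push (f t s) (b s) (G t) = G s"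
  unfolding lim_smash_def by blast+

lemma zero_in_L: "0 \<in> L"
  by (auto simp: lim_smash_def smash_def push_def fun_eq_iff)

lemma L_diff:
  assumes G: "G \<in> L" "G' \<in> L"
  shows "G - G' \<in> L"
  unfolding lim_smash_def
proof (intro CollectI conjI allI impI)
  show "(G - G') t \<in> smash (P t) (b t)" for t
    using smash_diff[OF L_smash[OF G(1), of t] L_smash[OF G(2), of t]] by simp
  show "push (f t s) (b s) ((G - G') t) = (G - G') s" if "s \<le> t" for t s
    using G that by (simp add: push_diff smash_finite[OF L_smash] L_push)
qed

text \<open>The value at \<open>t\<close> is pushed forward from every later index, so each point of
  its support has a preimage there.\<close>

lemma L_support_stable:
  assumes "G \<in> L" "G t y \<noteq> 0"
  shows "y \<in> stable t"
  unfolding stable_def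
proof
  fix s assume "s \<in> {t..}"
  then have "push (f s t) (b t) (G s) y \<noteq> 0" using assms L_push by simp
  then obtain x where x: "G s x \<noteq> 0" "f s t x = y" using push_nonzeroD(2) by metis
  then have "x \<in> P s" using smash_nonzeroD[OF L_smash[OF assms(1)] x(1)] by simp
  then show "y \<in> f s t ` P s" using x(2) by blast
qed

lemma rho_in_L:
  assumes g: "g \<in> smash X_lim b"
  shows "rho b g \<in> L"
  unfolding lim_smash_def rho_def
proof (intro CollectI conjI allI impI)
  show "push (\<lambda>x. x t) (b t) g \<in> smash (P t) (b t)" for t
    by (rule push_smash[OF g]) (simp add: lim_pset_def)
  show "push (f t s) (b s) (push (\<lambda>x. x t) (b t) g) = push (\<lambda>x. x s) (b s) g" if "s \<le> t" for t s
  proof -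
    have "push (f t s) (b s) (push (\<lambda>x. x t) (b t) g) = push (\<lambda>x. f t s (x t)) (b s) g"
      by (rule push_comp[OF smash_finite[OF g]]) (rule map_base[OF that])
    also have "\<dots> = push (\<lambda>x. x s) (b s) g"
      by (rule push_cong) (use smash_nonzeroD[OF g] that in \<open>auto simp: lim_pset_def\<close>)
    finally show ?thesis .
  qed
qed

lemma N_sub_L: "N \<subseteq> L"
  unfolding rho_image_def using rho_in_L by blast

lemma rho_diff:
  assumes "g \<in> smash Y b0" "g' \<in> smash Y b0"
  shows "rho b (g - g') = rho b g - rho b g'"
proof
  fix t
  have "push (\<lambda>x. x t) (b t) (g - g') = push (\<lambda>x. x t) (b t) g - push (\<lambda>x. x t) (b t) g'"
    by (rule push_diff) (rule assms[THEN smash_finite])+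
  then show "rho b (g - g') t = (rho b g - rho b g') t" unfolding rho_def by (simp only: minus_apply)
qed

lemma N_diff:
  assumes "x \<in> N" "y \<in> N"
  shows "x - y \<in> N"
proof -
  obtain g g' where "x = rho b g" "y = rho b g'" and g: "g \<in> smash X_lim b" "g' \<in> smash X_lim b"
    using assms by (auto simp: rho_image_def)
  then have "x - y = rho b (g - g')" using rho_diff[OF g] by simp
  then show ?thesis unfolding rho_image_def using smash_diff[OF g] by blast
qed

lemma zero_in_N: "0 \<in> N"
proof -
  have "rho b (\<lambda>_. 0) = (0 :: 't \<Rightarrow> 'x \<Rightarrow> 'a)" by (simp add: rho_def push_def fun_eq_iff)
  moreover have "(\<lambda>_. 0) \<in> smash X_lim b" by (simp add: smash_def)
  then have "rho b (\<lambda>_. 0) \<in> N" unfolding rho_image_def by (rule imageI)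
  ultimately show ?thesis by simp
qed

lemma N_add: "x \<in> N \<Longrightarrow> y \<in> N \<Longrightarrow> x + y \<in> N"
  using N_diff[of x "0 - y"] N_diff[of 0 y] zero_in_N by simp

lemma L_add: "x \<in> L \<Longrightarrow> y \<in> L \<Longrightarrow> x + y \<in> L"
  using L_diff[of x "0 - y"] L_diff[of 0 y] zero_in_L by simp

section \<open>Splitting off finitely many elements of \<open>N\<close>\<close>

text \<open>Threads that differ at an index differ at all later ones, so an upper bound of the
  indices separating the finitely many pairs works.\<close>

lemma separating_index:
  assumes fin: "finite E" and sub: "E \<subseteq> X_lim"
  shows "\<exists>t. inj_on (\<lambda>\<xi>. \<xi> t) E"
proof -
  have "\<forall>p. \<exists>t. fst p \<noteq> snd p \<longrightarrow> fst p t \<noteq> (snd p t :: 'x)" by (auto simp: fun_eq_iff)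
  from choice[OF this] obtain T :: "('t \<Rightarrow> 'x) \<times> ('t \<Rightarrow> 'x) \<Rightarrow> 't"
    where T: "\<forall>p. fst p \<noteq> snd p \<longrightarrow> fst p (T p) \<noteq> snd p (T p)" by blast
  obtain t where t: "\<And>p. p \<in> E \<times> E \<Longrightarrow> T p \<le> t"
    using finite_upper_bound[of "T ` (E \<times> E)"] fin by auto
  have "inj_on (\<lambda>\<xi>. \<xi> t) E"
  proof (rule inj_onI, rule ccontr)
    fix \<xi> \<eta> assume E: "\<xi> \<in> E" "\<eta> \<in> E" and eq: "\<xi> t = \<eta> t" and ne: "\<xi> \<noteq> \<eta>"
    let ?s = "T (\<xi>, \<eta>)"
    have "\<xi> ?s = f t ?s (\<xi> t)" "\<eta> ?s = f t ?s (\<eta> t)"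
      using E sub t[of "(\<xi>, \<eta>)"] by (auto simp: lim_pset_def)
    then show False using eq T[rule_format, of "(\<xi>, \<eta>)"] ne by simp
  qed
  then show ?thesis by blast
qed

text \<open>Once the finitely many threads involved have distinct values at \<open>t\<close>, the coefficients of a
  combination of them can be read off from its value at \<open>t\<close>.\<close>

lemma N_locally_split:
  assumes fin: "finite F" and sub: "F \<subseteq> N"
  shows "\<exists>\<phi>. \<phi> ` L \<subseteq> N \<and> (\<forall>x\<in>L. \<forall>y\<in>L. \<phi> (x - y) = \<phi> x - \<phi> y) \<and> (\<forall>x\<in>F. \<phi> x = x)"
proof -
  have "\<forall>x\<in>F. \<exists>g. g \<in> smash X_lim b \<and> rho b g = x" using sub by (auto simp: rho_image_def)
  from bchoice[OF this] obtain g where "\<forall>x\<in>F. g x \<in> smash X_lim b \<and> rho b (g x) = x" by blast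
  then have g: "g x \<in> smash X_lim b" and rho_g: "rho b (g x) = x" if "x \<in> F" for x
    using that by blast+
  define E where "E = (\<Union>x\<in>F. {\<xi>. g x \<xi> \<noteq> 0})"
  have E_fin: "finite E" using fin smash_finite[OF g] by (simp add: E_def)
  have E_lim: "E \<subseteq> X_lim" and b_E: "b \<notin> E" using smash_nonzeroD[OF g] by (auto simp: E_def)
  \<comment> \<open>The base thread \<open>b\<close> is separated too, since coefficients over
    \<open>b t\<close> are lost under push-forward.\<close>
  obtain t where inj: "inj_on (\<lambda>\<xi>. \<xi> t) (insert b E)"
    using separating_index[of "insert b E"] E_fin E_lim base_in_lim by auto
  define q where "q G \<xi> = (if \<xi> \<in> E then G t (\<xi> t) else 0)" for G :: "'t \<Rightarrow> 'x \<Rightarrow> 'a" and \<xi>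
  have q_smash: "q G \<in> smash X_lim b" for G
  proof -
    have "{\<xi>. q G \<xi> \<noteq> 0} \<subseteq> E" by (auto simp: q_def)
    then have "finite {\<xi>. q G \<xi> \<noteq> 0}" using E_fin by (rule finite_subset)
    then show ?thesis using E_lim b_E by (auto simp: smash_def q_def)
  qed
  have q_diff: "q (G - G') = q G - q G'" for G G' by (simp add: q_def fun_eq_iff)
  have q_g: "q x = g x" if x: "x \<in> F" for x
  proof
    fix \<xi>
    have supp: "{\<xi>. g x \<xi> \<noteq> 0} \<subseteq> E" using x by (auto simp: E_def)
    show "q x \<xi> = g x \<xi>"
    proof (cases "\<xi> \<in> E")
      case True
      then have ne: "\<xi> t \<noteq> b t" using inj b_E by (auto simp: inj_on_def)
      have "q x \<xi> = rho b (g x) t (\<xi> t)" using True rho_g[OF x] by (simp add: q_def)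
      also have "\<dots> = (\<Sum>\<eta>\<in>{\<eta> \<in> E. \<eta> t = \<xi> t}. g x \<eta>)"
        unfolding rho_def using E_fin supp ne by (rule push_eq_sum)
      also have "{\<eta> \<in> E. \<eta> t = \<xi> t} = {\<xi>}" using inj True by (auto simp: inj_on_def)
      finally show ?thesis by simp
    qed (use supp in \<open>auto simp: q_def\<close>)
  qed
  define \<phi> where "\<phi> G = rho b (q G)" for G
  have "\<phi> ` L \<subseteq> N" using q_smash by (auto simp: \<phi>_def rho_image_def)
  moreover have "\<phi> (x - y) = \<phi> x - \<phi> y" for x y
    unfolding \<phi>_def q_diff by (rule rho_diff[OF q_smash q_smash])
  moreover have "\<phi> x = x" if "x \<in> F" for x using q_g[OF that] rho_g[OF that] by (simp add: \<phi>_def)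
  ultimately show ?thesis by blast
qed

section \<open>Truncations and their infinite sums\<close>

text \<open>A chosen thread through each stable point. The default \<open>b\<close> is harmless,
  because elements of \<open>L\<close> are supported on stable points.\<close>

definition section_lim :: "'t \<Rightarrow> 'x \<Rightarrow> 't \<Rightarrow> 'x" where
  "section_lim t x = (if x \<in> stable t then SOME \<xi>. \<xi> \<in> X_lim \<and> \<xi> t = x else b)"

lemma section_lim_in: "section_lim t x \<in> X_lim"
  and section_lim_eval: "x \<in> stable t \<Longrightarrow> section_lim t x t = x"
proof -
  have *: "section_lim t x \<in> X_lim \<and> section_lim t x t = x" if x: "x \<in> stable t"
  proof -
    obtain \<xi> where "\<xi> \<in> X_lim" "\<xi> t = x" by (rule stable_lift[OF x])
    then have "\<xi> \<in> X_lim \<and> \<xi> t = x" ..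
    then show ?thesis
      unfolding section_lim_def if_P[OF x] by (rule someI[where P = "\<lambda>\<xi>. \<xi> \<in> X_lim \<and> \<xi> t = x"])
  qed
  then show "section_lim t x \<in> X_lim" using base_in_lim by (cases "x \<in> stable t") (simp_all add: section_lim_def)
  show "x \<in> stable t \<Longrightarrow> section_lim t x t = x" using * by blast
qed

text \<open>Each support point of \<open>G t\<close> is replaced by its chosen thread; for
  \<open>G\<close> in \<open>L\<close> the result lies in \<open>N\<close> and agrees with
  \<open>G\<close> at all indices up to \<open>t\<close>.\<close>

definition truncation :: "'t \<Rightarrow> ('t \<Rightarrow> 'x \<Rightarrow> 'a) \<Rightarrow> 't \<Rightarrow> 'x \<Rightarrow> 'a" where
  "truncation t G = rho b (push (section_lim t) b (G t))"

lemma truncation_in_N: "G \<in> L \<Longrightarrow> truncation t G \<in> N"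
  unfolding truncation_def rho_image_def
  by (intro imageI push_smash[OF L_smash] section_lim_in)

lemma truncation_diff:
  assumes "G \<in> L" "G' \<in> L"
  shows "truncation t (G - G') = truncation t G - truncation t G'"
proof -
  have "push (section_lim t) b (G t) \<in> smash X_lim b" "push (section_lim t) b (G' t) \<in> smash X_lim b"
    using assms by (auto intro!: push_smash[OF L_smash] section_lim_in)
  then show ?thesis
    by (simp add: truncation_def push_diff[OF assms[THEN L_smash, THEN smash_finite]] rho_diff)
qed

text \<open>At \<open>t\<close> itself, choosing a thread and evaluating it is the identity on the
  support of \<open>G t\<close>. Both sides lie in \<open>L\<close>, so the agreement passes down to
  \<open>s\<close>.\<close>

lemma truncation_eval:
  assumes G: "G \<in> L" and st: "s \<le> t"
  shows "truncation t G s = G s"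
proof -
  have fin: "finite {x. G t x \<noteq> 0}" using smash_finite[OF L_smash[OF G]] .
  have Gb: "G t (b t) = 0" using L_smash[OF G, of t] by (simp add: smash_def)
  have eval: "section_lim t x t = x" if "G t x \<noteq> 0" for x
    using L_support_stable[OF G that] by (rule section_lim_eval)
  have "push (\<lambda>\<xi>. \<xi> t) (b t) (push (section_lim t) b (G t)) = push (\<lambda>x. section_lim t x t) (b t) (G t)"
    by (rule push_comp[OF fin]) simp
  also have "\<dots> = G t" using eval Gb by (rule push_ident)
  finally have "truncation t G t = G t" by (simp add: truncation_def rho_def)
  moreover have "truncation t G \<in> L" using truncation_in_N[OF G] N_sub_L by blast
  ultimately show ?thesis using L_push[OF _ st] G by metis
qed

lemma truncation_add:
  assumes "G \<in> L" "G' \<in> L"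
  shows "truncation t (G + G') = truncation t G + truncation t G'"
  using truncation_diff[OF L_add[OF assms] assms(2), of t] by (simp add: algebra_simps)

text \<open>\<open>S y\<close> is the infinite sum of the terms \<open>\<Delta> m (y m)\<close>, where \<open>\<Delta> m\<close> is the difference of the truncations
  at \<open>c (m + 1)\<close> and \<open>c m\<close>. It makes sense because \<open>\<Delta> m\<close> vanishes at all indices below \<open>c m\<close>, and
  it telescopes where \<open>y\<close> is constant.\<close>

lemma diagonal_sum:
  "\<exists>S :: (nat \<Rightarrow> 't \<Rightarrow> 'x \<Rightarrow> 'a) \<Rightarrow> 't \<Rightarrow> 'x \<Rightarrow> 'a.
    (\<forall>y. range y \<subseteq> L \<longrightarrow> S y \<in> L) \<and>
    (\<forall>y z. range y \<subseteq> L \<longrightarrow> range z \<subseteq> L \<longrightarrow> S (\<lambda>n. y n + z n) = S y + S z) \<and>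
    (\<forall>y n\<^sub>0 a. range y \<subseteq> L \<longrightarrow> a \<in> L \<longrightarrow> (\<forall>n\<ge>n\<^sub>0. y n = a) \<longrightarrow> S y - a \<in> N)"
proof -
  obtain c :: "nat \<Rightarrow> 't" where c: "incseq c" "\<And>t. \<exists>n. t \<le> c n"
    using cofinal_sequence by metis
  define \<Delta> where "\<Delta> m G = truncation (c (Suc m)) G - truncation (c m) G" for m G
  define K where "K t = (LEAST n. t \<le> c n)" for t
  have K: "t \<le> c (K t)" for t unfolding K_def using c(2) by (rule LeastI_ex)
  have K_le: "K t \<le> n" if "t \<le> c n" for t n unfolding K_def using that by (rule Least_le)
  define \<sigma> where "\<sigma> k y = (\<Sum>m<k. \<Delta> m (y m))" for k y
  have \<sigma>_Suc: "\<sigma> (Suc k) y = \<sigma> k y + \<Delta> k (y k)" for k y by (simp add: \<sigma>_def)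
  \<comment> \<open>Terms from \<open>K t\<close> on vanish at \<open>t\<close>, so this finite
    partial sum already is the full sum there.\<close>
  define S where "S y t = \<sigma> (K t) y t" for y t
  have \<Delta>_N: "\<Delta> m G \<in> N" if "G \<in> L" for m G
    unfolding \<Delta>_def using that by (intro N_diff truncation_in_N)
  have \<Delta>_zero: "\<Delta> m G t = 0" if "G \<in> L" "t \<le> c m" for m G t
  proof -
    have "t \<le> c (Suc m)" using that(2) incseq_SucD[OF c(1)] order_trans by blast
    then show ?thesis using that by (simp add: \<Delta>_def truncation_eval)
  qed
  have \<Delta>_add: "\<Delta> m (G + G') = \<Delta> m G + \<Delta> m G'" if "G \<in> L" "G' \<in> L" for m G G'
    using that by (simp add: \<Delta>_def truncation_add)
  have \<sigma>_N: "\<sigma> k y \<in> N" if "range y \<subseteq> L" for k y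
  proof (induction k)
    case 0
    show ?case unfolding \<sigma>_def lessThan_0 sum.empty by (rule zero_in_N)
  next
    case (Suc k)
    have "y k \<in> L" using that by auto
    then show ?case unfolding \<sigma>_Suc using Suc by (intro N_add \<Delta>_N)
  qed
  have S_eq: "S y t = \<sigma> k y t" if y: "range y \<subseteq> L" and t: "t \<le> c k" for y t k
    using K_le[OF t]
  proof (induction rule: dec_induct)
    case base
    then show ?case by (simp add: S_def)
  next
    case (step n)
    have "y n \<in> L" using y by auto
    moreover have "t \<le> c n" using K[of t] incseqD[OF c(1) step(1)] by (rule order_trans)
    ultimately show ?case using step by (simp add: \<sigma>_Suc \<Delta>_zero)
  qed
  have S_L: "S y \<in> L" if y: "range y \<subseteq> L" for y
    unfolding lim_smash_def
  proof (intro CollectI conjI allI impI)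
    have \<sigma>_L: "\<sigma> k y \<in> L" for k using \<sigma>_N[OF y] N_sub_L by blast
    show "S y t \<in> smash (P t) (b t)" for t unfolding S_def by (rule L_smash[OF \<sigma>_L])
    fix t s :: 't assume st: "s \<le> t"
    have "S y s = \<sigma> (K t) y s" using st K by (intro S_eq[OF y]) (rule order_trans)
    then show "push (f t s) (b s) (S y t) = S y s"
      using L_push[OF \<sigma>_L st] by (simp add: S_def)
  qed
  have S_add: "S (\<lambda>n. y n + z n) = S y + S z" if y: "range y \<subseteq> L" and z: "range z \<subseteq> L" for y z
  proof -
    have "\<Delta> m (y m + z m) = \<Delta> m (y m) + \<Delta> m (z m)" for m
      using y z by (intro \<Delta>_add) auto
    then have "\<sigma> k (\<lambda>n. y n + z n) = \<sigma> k y + \<sigma> k z" for k by (simp add: \<sigma>_def sum.distrib)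
    then show ?thesis by (intro ext) (simp add: S_def)
  qed
  have S_const: "S y - a \<in> N"
    if y: "range y \<subseteq> L" and a: "a \<in> L" and const: "\<forall>n\<ge>n\<^sub>0. y n = a" for y n\<^sub>0 a
  proof -
    have \<sigma>_telescope: "\<sigma> k y = \<sigma> n\<^sub>0 y + (truncation (c k) a - truncation (c n\<^sub>0) a)" if "n\<^sub>0 \<le> k" for k
      using that
    proof (induction rule: dec_induct)
      case (step n)
      then show ?case by (simp add: \<sigma>_Suc \<Delta>_def const algebra_simps)
    qed simp
    \<comment> \<open>Above \<open>n\<^sub>0\<close> the sum telescopes to a difference of
      truncations of \<open>a\<close>; at \<open>t\<close> the later truncation equals
      \<open>a\<close>, and what remains is an element of \<open>N\<close> independent of
      \<open>t\<close>.\<close>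
    have "(S y - a) t = (\<sigma> n\<^sub>0 y - truncation (c n\<^sub>0) a) t" for t
    proof -
      define k where "k = max n\<^sub>0 (K t)"
      have "c (K t) \<le> c k" by (intro incseqD[OF c(1)]) (simp add: k_def)
      with K[of t] have t: "t \<le> c k" by (rule order_trans)
      have "S y t = \<sigma> k y t" by (rule S_eq[OF y t])
      then show ?thesis
        using \<sigma>_telescope[of k] truncation_eval[OF a t] by (simp add: k_def)
    qed
    then have "S y - a = \<sigma> n\<^sub>0 y - truncation (c n\<^sub>0) a" by (rule ext)
    then show ?thesis using \<sigma>_N[OF y] truncation_in_N[OF a] by (simp add: N_diff)
  qed
  show ?thesis by (intro exI[of _ S] conjI allI impI; rule S_L S_add S_const; assumption)
qed

section \<open>The quotient group and the conclusion\<close>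

abbreviation L_group :: "('t \<Rightarrow> 'x \<Rightarrow> 'a) monoid" where
  "L_group \<equiv> lim_smash_group P b f"

lemma L_group_simps [simp]:
  "carrier L_group = L" "x \<otimes>\<^bsub>L_group\<^esub> y = x + y" "\<one>\<^bsub>L_group\<^esub> = 0"
  by (simp_all add: lim_smash_group_def fun_eq_iff)

lemma comm_group_L: "comm_group L_group"
proof (rule comm_groupI)
  fix x assume "x \<in> carrier L_group"
  then show "\<exists>y\<in>carrier L_group. y \<otimes>\<^bsub>L_group\<^esub> x = \<one>\<^bsub>L_group\<^esub>"
    using L_diff[OF zero_in_L, of x] by (auto intro!: bexI[of _ "0 - x"])
qed (auto simp: L_add zero_in_L algebra_simps)

lemma subgroup_N: "subgroup N L_group"
proof -
  interpret comm_group L_group by (rule comm_group_L)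
  show ?thesis
  proof (rule subgroupI)
    show "N \<subseteq> carrier L_group" using N_sub_L by simp
    show "N \<noteq> {}" using zero_in_N by auto
    show "x \<otimes>\<^bsub>L_group\<^esub> y \<in> N" if "x \<in> N" "y \<in> N" for x y using that by (simp add: N_add)
    fix x assume x: "x \<in> N"
    have "- x \<in> N" using N_diff[OF zero_in_N x] by simp
    moreover have "inv\<^bsub>L_group\<^esub> x = - x"
      using x \<open>- x \<in> N\<close> N_sub_L by (intro inv_equality) auto
    ultimately show "inv\<^bsub>L_group\<^esub> x \<in> N" by simp
  qed
qed

text \<open>The diagonal limit is \<open>S\<close> followed by the projection \<open>\<pi>\<close>:
  the error \<open>S y - a\<close> for eventually constant sequences lies in \<open>N\<close> and
  disappears in the quotient.\<close>

lemma alg_compact_H_group: "alg_compact (H_group P b f TYPE('a)) TYPE('b)"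
proof -
  interpret G: comm_group L_group by (rule comm_group_L)
  interpret N: normal N L_group by (rule G.subgroup_imp_normal[OF subgroup_N])
  obtain S :: "(nat \<Rightarrow> 't \<Rightarrow> 'x \<Rightarrow> 'a) \<Rightarrow> 't \<Rightarrow> 'x \<Rightarrow> 'a" where S_L: "\<forall>y. range y \<subseteq> L \<longrightarrow> S y \<in> L"
    and S_add: "\<forall>y z. range y \<subseteq> L \<longrightarrow> range z \<subseteq> L \<longrightarrow> S (\<lambda>n. y n + z n) = S y + S z"
    and S_const: "\<forall>y n\<^sub>0 a. range y \<subseteq> L \<longrightarrow> a \<in> L \<longrightarrow> (\<forall>n\<ge>n\<^sub>0. y n = a) \<longrightarrow> S y - a \<in> N"
    using diagonal_sum by (elim exE conjE) (rule that)
  define H where "H = H_group P b f TYPE('a)"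
  define \<pi> where "\<pi> x = N #>\<^bsub>L_group\<^esub> x" for x
  have H: "H = L_group Mod N" by (simp add: H_def H_group_def)
  have \<pi>_add: "\<pi> (x + y) = \<pi> x \<otimes>\<^bsub>H\<^esub> \<pi> y" if "x \<in> L" "y \<in> L" for x y
    using hom_mult[OF N.r_coset_hom_Mod, of x y] that by (simp add: \<pi>_def H)
  have \<pi>_image: "\<pi> ` L = carrier H" by (simp add: H carrier_FactGroup \<pi>_def)
  have \<pi>_kernel: "{x \<in> L. \<pi> x = \<one>\<^bsub>H\<^esub>} = N"
    using G.coset_join1[OF _ _ subgroup_N] G.coset_join2[OF _ subgroup_N] N_sub_L
    by (auto simp: \<pi>_def H)
  interpret diagonal_quotient H L \<pi> "\<lambda>y. \<pi> (S y)"
  proof (intro diagonal_quotient.intro diagonal_quotient_axioms.intro)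
    show comm: "comm_group H" unfolding H by (rule G.abelian_FactGroup[OF subgroup_N])
    interpret H: comm_group H by (rule comm)
    show "0 \<in> L" by (rule zero_in_L)
    show "x - y \<in> L" if "x \<in> L" "y \<in> L" for x y using that by (rule L_diff)
    show "\<pi> ` L = carrier H" by (rule \<pi>_image)
    show "\<pi> (x + y) = \<pi> x \<otimes>\<^bsub>H\<^esub> \<pi> y" if "x \<in> L" "y \<in> L" for x y using that by (rule \<pi>_add)
    show "\<exists>\<phi>. \<phi> ` L \<subseteq> {x \<in> L. \<pi> x = \<one>\<^bsub>H\<^esub>} \<and> (\<forall>x\<in>L. \<forall>y\<in>L. \<phi> (x - y) = \<phi> x - \<phi> y) \<and> (\<forall>x\<in>F. \<phi> x = x)"
      if "finite F" "F \<subseteq> {x \<in> L. \<pi> x = \<one>\<^bsub>H\<^esub>}" for F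
      using that unfolding \<pi>_kernel by (rule N_locally_split)
    show "\<pi> (S y) \<in> carrier H" if "range y \<subseteq> L" for y
      using S_L that \<pi>_image by blast
    show "\<pi> (S (\<lambda>n. y n + z n)) = \<pi> (S y) \<otimes>\<^bsub>H\<^esub> \<pi> (S z)" if "range y \<subseteq> L" "range z \<subseteq> L" for y z
      using that by (simp add: S_add \<pi>_add S_L)
    show "\<pi> (S y) = \<pi> a" if y: "range y \<subseteq> L" and a: "a \<in> L" and const: "\<And>n. n\<^sub>0 \<le> n \<Longrightarrow> y n = a" for y n\<^sub>0 a
    proof -
      have "S y - a \<in> N" using S_const y a const by blast
      then have d: "S y - a \<in> L" "\<pi> (S y - a) = \<one>\<^bsub>H\<^esub>" using \<pi>_kernel by auto
      have "\<pi> a \<in> carrier H" using a \<pi>_image by blast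
      then show ?thesis using \<pi>_add[OF d(1) a] d(2) by simp
    qed
  qed
  show ?thesis using alg_compact unfolding H_def .
qed

end

theorem mainTheorem16:
  fixes P :: "'t::order \<Rightarrow> 'x set" and b :: "'t \<Rightarrow> 'x"
    and f :: "'t \<Rightarrow> 't \<Rightarrow> 'x \<Rightarrow> 'x"
  assumes "countable (UNIV :: 't set)"
    and "directed_poset TYPE('t)"
    and "pointed_diagram P b f"
    and "mittag_leffler P f"
  shows "alg_compact (H_group P b f TYPE('a::ab_group_add)) TYPE('b)"
proof -
  interpret mittag_leffler_diagram P b f "TYPE('a)"
    using assms by unfold_locales
  show ?thesis by (rule alg_compact_H_group)
qed

end
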